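(* Let $k\geq 2$ and $n\geq 400k^{2}$ be integers, and let $G$ be a graph of order $n$ with maximum degree $\Delta(G)=n-1$. If $q(G)\geq q(S_{n,k}^{+})$, then $G$ contains a cycle of length $2k+2$, unless $G=S_{n,k}^{+}$ (up to isomorphism).
   Context: All graphs are finite and simple. For a graph $G$, the signless Laplacian is $Q(G)=D(G)+A(G)$, where $D(G)$ is the diagonal matrix of vertex degrees and $A(G)$ the adjacency matrix; $q(G)$ denotes the largest eigenvalue of $Q(G)$. For $1\le k<n$, $S_{n,k}=K_k\vee\overline{K}_{n-k}$ is the graph obtained by joining each vertex of a complete graph of order $k$ to each vertex of an independent set of order $n-k$, and $S_{n,k}^{+}$ is the graph obtained from $S_{n,k}$ by adding one edge. *)

theory Defs
  imports
    "Graph_Theory.Pair_Digraph"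
    "Graph_Theory.Digraph_Isomorphism"
    "Jordan_Normal_Form.Spectral_Radius"
begin

text \<open>
  A finite simple graph is a \<^locale>\<open>pair_graph\<close>: a finite, loop-free, symmetric set of arcs.
  An edge \<open>uv\<close> is the pair of arcs \<open>(u,v)\<close>, \<open>(v,u)\<close>, so the degree of a vertex is its
  \<^const>\<open>out_degree\<close>. A \<^const>\<open>pre_digraph.cycle\<close> of the symmetric digraph is a cycle
  of the undirected graph as soon as its length is at least 3; only such lengths are used.
\<close>

definition max_degree :: "'a pair_pre_digraph \<Rightarrow> nat" where
  "max_degree G = Max (out_degree G ` pverts G)"

definition complete_graph :: "'a set \<Rightarrow> 'a pair_pre_digraph" where
  "complete_graph V = \<lparr> pverts = V, parcs = {(u, v). u \<in> V \<and> v \<in> V \<and> u \<noteq> v} \<rparr>"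

definition complement :: "'a pair_pre_digraph \<Rightarrow> 'a pair_pre_digraph" where
  "complement G = \<lparr> pverts = pverts G,
     parcs = {(u, v). u \<in> pverts G \<and> v \<in> pverts G \<and> u \<noteq> v \<and> (u, v) \<notin> parcs G} \<rparr>"

text \<open>The vertex sets of the two graphs are meant to be disjoint.\<close>

definition graph_join :: "'a pair_pre_digraph \<Rightarrow> 'a pair_pre_digraph \<Rightarrow> 'a pair_pre_digraph" where
  "graph_join G H = \<lparr> pverts = pverts G \<union> pverts H,
     parcs = parcs G \<union> parcs H \<union> pverts G \<times> pverts H \<union> pverts H \<times> pverts G \<rparr>"

definition add_edge :: "'a \<Rightarrow> 'a \<Rightarrow> 'a pair_pre_digraph \<Rightarrow> 'a pair_pre_digraph" where
  "add_edge u v G = G\<lparr> parcs := parcs G \<union> {(u, v), (v, u)} \<rparr>"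

definition S_graph :: "nat \<Rightarrow> nat \<Rightarrow> nat pair_pre_digraph" where
  "S_graph n k = graph_join (complete_graph {0..<k}) (complement (complete_graph {k..<n}))"

text \<open>
  The non-adjacent pairs of \<open>S_graph n k\<close> are the pairs in the independent part \<open>{k..<n}\<close>, and
  they are all equivalent under automorphisms; we add \<open>{k, k + 1}\<close>, for which \<open>k + 2 \<le> n\<close> is
  needed.
\<close>

definition S_plus_graph :: "nat \<Rightarrow> nat \<Rightarrow> nat pair_pre_digraph" where
  "S_plus_graph n k = add_edge k (k + 1) (S_graph n k)"

text \<open>
  Matrices are indexed by \<open>{0..<n}\<close>, so the matrix of a graph is taken with respect to a list
  enumerating its vertices.
\<close>

definition adjacency_matrix :: "'a pair_pre_digraph \<Rightarrow> 'a list \<Rightarrow> real mat" where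
  "adjacency_matrix G vs = mat (length vs) (length vs)
     (\<lambda>(i, j). if (vs ! i, vs ! j) \<in> parcs G then 1 else 0)"

definition degree_matrix :: "'a pair_pre_digraph \<Rightarrow> 'a list \<Rightarrow> real mat" where
  "degree_matrix G vs = mat (length vs) (length vs)
     (\<lambda>(i, j). if i = j then real (out_degree G (vs ! i)) else 0)"

definition signless_laplacian :: "'a pair_pre_digraph \<Rightarrow> 'a list \<Rightarrow> real mat" where
  "signless_laplacian G vs = degree_matrix G vs + adjacency_matrix G vs"

text \<open>
  The choice of the enumeration is immaterial by \<open>spectrum_signless_laplacian_cong\<close> below. The
  matrix is real symmetric, so its real spectrum is its whole spectrum.
\<close>

definition q_index :: "'a pair_pre_digraph \<Rightarrow> real" where
  "q_index G =
     Max (spectrum (signless_laplacian G (SOME vs. distinct vs \<and> set vs = pverts G)))"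

lemma signless_laplacian_index:
  assumes "i < length vs" "j < length vs"
  shows "signless_laplacian G vs $$ (i, j) =
    (if i = j then real (out_degree G (vs ! i)) else 0) +
    (if (vs ! i, vs ! j) \<in> parcs G then 1 else 0)"
  using assms by (simp add: signless_laplacian_def degree_matrix_def adjacency_matrix_def)

lemma signless_laplacian_carrier:
  "signless_laplacian G vs \<in> carrier_mat (length vs) (length vs)"
  by (simp add: signless_laplacian_def degree_matrix_def adjacency_matrix_def)

lemma spectrum_signless_laplacian_subset:
  assumes vs: "distinct vs" and ws: "distinct ws" and eq: "set vs = set ws"
  shows "spectrum (signless_laplacian G vs) \<subseteq> spectrum (signless_laplacian G ws)"
proof
  fix c assume "c \<in> spectrum (signless_laplacian G vs)"
  then obtain x where x: "x \<in> carrier_vec (length vs)" "x \<noteq> 0\<^sub>v (length vs)"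
    "signless_laplacian G vs *\<^sub>v x = c \<cdot>\<^sub>v x"
    using signless_laplacian_carrier[of G vs]
    by (auto simp: spectrum_def eigenvalue_def eigenvector_def)
  define n where "n = length vs"
  have n: "length vs = n" "length ws = n"
    using vs ws eq by (simp_all add: n_def flip: distinct_card)
  have bv: "bij_betw (\<lambda>i. vs ! i) {..<n} (set vs)" and bw: "bij_betw (\<lambda>i. ws ! i) {..<n} (set vs)"
    using vs ws n eq by (auto intro!: bij_betw_nth)
  define p where "p = (\<lambda>i. inv_into {..<n} ((!) vs) (ws ! i))"
  have p: "bij_betw p {..<n} {..<n}"
    using bij_betw_trans[OF bw bij_betw_inv_into[OF bv]] by (simp add: p_def comp_def)
  have pn: "p i < n" and vp: "vs ! p i = ws ! i" if "i < n" for i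
    using p bij_betwE[OF bw] bv that
    by (auto simp: p_def bij_betw_def intro!: f_inv_into_f)
  define y where "y = vec n (\<lambda>i. x $ p i)"
  have Q: "signless_laplacian G ws $$ (i, j) = signless_laplacian G vs $$ (p i, p j)"
    if "i < n" "j < n" for i j
    using that pn vp p n by (auto simp: signless_laplacian_index bij_betw_def inj_on_def)
  have "signless_laplacian G ws *\<^sub>v y = c \<cdot>\<^sub>v y"
  proof (rule eq_vecI)
    fix i assume "i < dim_vec (c \<cdot>\<^sub>v y)"
    then have i: "i < n" by (simp add: y_def)
    have "(signless_laplacian G ws *\<^sub>v y) $ i = (\<Sum>j<n. signless_laplacian G vs $$ (p i, p j) * x $ p j)"
      using i n Q signless_laplacian_carrier[of G ws]
      by (auto simp: scalar_prod_def y_def atLeast0LessThan intro!: sum.cong)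
    also have "\<dots> = (\<Sum>j<n. signless_laplacian G vs $$ (p i, j) * x $ j)"
      by (rule sum.reindex_bij_betw[OF p])
    also have "\<dots> = (signless_laplacian G vs *\<^sub>v x) $ p i"
      using pn[OF i] n x(1) signless_laplacian_carrier[of G vs]
      by (auto simp: scalar_prod_def atLeast0LessThan intro!: sum.cong)
    also have "\<dots> = (c \<cdot>\<^sub>v y) $ i"
      using x n i pn[OF i] by (simp add: y_def)
    finally show "(signless_laplacian G ws *\<^sub>v y) $ i = (c \<cdot>\<^sub>v y) $ i" .
  qed (use n signless_laplacian_carrier[of G ws] in \<open>auto simp: y_def\<close>)
  moreover have "y \<noteq> 0\<^sub>v n"
  proof
    assume y: "y = 0\<^sub>v n"
    have "x $ j = 0" if j: "j < n" for j
    proof -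
      obtain i where i: "i < n" "j = p i" using p j by (auto simp: bij_betw_def)
      then have "x $ j = y $ i" by (simp add: y_def)
      with y i show ?thesis by simp
    qed
    then have "x = 0\<^sub>v n" using x(1) n by (intro eq_vecI) auto
    with x(2) n show False by simp
  qed
  ultimately show "c \<in> spectrum (signless_laplacian G ws)"
    using n signless_laplacian_carrier[of G ws]
    by (auto simp: spectrum_def eigenvalue_def eigenvector_def y_def intro!: exI[of _ y])
qed

lemma spectrum_signless_laplacian_cong:
  assumes "distinct vs" "distinct ws" "set vs = set ws"
  shows "spectrum (signless_laplacian G vs) = spectrum (signless_laplacian G ws)"
  using spectrum_signless_laplacian_subset assms by (metis subset_antisym)

lemma q_index_eq:
  assumes "distinct vs" "set vs = pverts G"
  shows "q_index G = Max (spectrum (signless_laplacian G vs))"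
proof -
  let ?P = "\<lambda>vs. distinct vs \<and> set vs = pverts G"
  have "?P (SOME vs. ?P vs)"
    by (rule someI[of ?P vs]) (use assms in simp)
  then show ?thesis
    using assms spectrum_signless_laplacian_cong[of "SOME vs. ?P vs" vs G]
    by (simp add: q_index_def)
qed

lemma pair_graph_S_plus_graph:
  assumes "k + 2 \<le> n"
  shows "pair_graph (S_plus_graph n k)"
proof -
  let ?S = "S_plus_graph n k"
  have V: "pverts ?S = {0..<n}"
    using assms by (auto simp: S_plus_graph_def S_graph_def add_edge_def graph_join_def
        complement_def complete_graph_def)
  have E: "parcs ?S = {(u, v). u < n \<and> v < n \<and> u \<noteq> v \<and>
      (u < k \<or> v < k \<or> (u = k \<and> v = k + 1) \<or> (u = k + 1 \<and> v = k))}"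
    using assms by (auto simp: S_plus_graph_def S_graph_def add_edge_def graph_join_def
        complement_def complete_graph_def)
  have "finite (parcs ?S)"
    by (rule finite_subset[of _ "{0..<n} \<times> {0..<n}"]) (auto simp: E)
  then show ?thesis
    by unfold_locales (auto simp: V E symmetric_def intro!: symI)
qed

end

theory Submission
  imports Defs "HOL-Analysis.Function_Topology"
begin

text \<open>
  Delete a dominating vertex \<open>w\<close>. If \<open>G\<close> has no cycle of length \<open>2k + 2\<close>, the remaining graph \<open>H\<close>
  on \<open>m = n - 1\<close> vertices has no path on \<open>2k + 1\<close> vertices. Scale the Perron vector \<open>x\<close> to
  \<open>x(w) = 1\<close> and let \<open>S\<close> be its sum over \<open>H\<close>; then \<open>q(G) = m + S\<close>, so \<open>S\<close> is at least
  \<open>2k - 1 - 1/200\<close>, and summing the eigenvalue equations gives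
  \<open>(m + S - 1) S = m + 2 \<Sum>\<^sub>v d(v) x(v)\<close>.

  Let \<open>A\<close> be the set of vertices of \<open>H\<close> of degree above \<open>3m/5\<close>. Any two of them have many common
  neighbours, so \<open>k\<close> of them would lie on an alternating path on \<open>2k + 1\<close> vertices; hence
  \<open>|A| \<le> k - 1\<close>. Vertices outside \<open>A\<close> have weight \<open>O(k/m)\<close> and, since \<open>H\<close> has fewer than \<open>2km\<close>
  edges, contribute only \<open>O(k\<^sup>2)\<close> to the sum of the \<open>d(v) x(v)\<close>. This forces \<open>|A| = k - 1\<close> and
  \<open>x \<ge> 9/10\<close> on \<open>A\<close>, and then every vertex of \<open>A\<close> is adjacent to all but \<open>O(k)\<close> vertices.
  A path on three vertices outside \<open>A\<close> with an end adjacent to \<open>A\<close> would extend to a path on \<open>2k + 1\<close>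
  vertices, so there are only \<open>O(m)\<close> edges outside \<open>A\<close>, contributing less than \<open>1/2\<close> to \<open>x\<^sup>T Q x\<close>.
  An edge missing at \<open>A\<close> would contribute at least \<open>(9/10)\<^sup>2\<close>, so adding the missing edges and deleting
  those outside \<open>A\<close> would increase the Rayleigh quotient to one of \<open>S\<^sub>n\<^sub>,\<^sub>k\<close>, which is impossible.
  Hence \<open>w\<close> and \<open>A\<close> are \<open>k\<close> dominating vertices, and at most one edge is left outside them.
\<close>

section \<open>The Q-index as maximum of the Rayleigh quotient\<close>

text \<open>With \<open>E\<close> the set of arcs, every edge is counted twice, so \<open>qform E x\<close> is
  \<open>2 \<cdot> x\<^sup>T Q x\<close>; \<open>qop E x\<close> is \<open>Q x\<close>.\<close>

definition qform :: "'a rel \<Rightarrow> ('a \<Rightarrow> real) \<Rightarrow> real" where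
  "qform E x = (\<Sum>(u, v)\<in>E. (x u + x v)\<^sup>2)"

definition qop :: "'a rel \<Rightarrow> ('a \<Rightarrow> real) \<Rightarrow> 'a \<Rightarrow> real" where
  "qop E x v = (\<Sum>u\<in>E `` {v}. x v + x u)"

locale finite_graph =
  fixes V :: "'a set" and E :: "'a rel"
  assumes finite_V: "finite V" and E_subset: "E \<subseteq> V \<times> V" and sym_E: "sym E"
begin

lemma finite_E: "finite E"
  using E_subset finite_V by (meson finite_SigmaI finite_subset)

lemma Image_subset: "E `` S \<subseteq> V"
  using E_subset by auto

lemma finite_Image [simp]: "finite (E `` S)"
  using Image_subset finite_V finite_subset by blast

lemma E_iff: "(u, v) \<in> E \<longleftrightarrow> (v, u) \<in> E"
  using sym_E by (auto dest: symD)

lemma sum_arcs: "(\<Sum>(u, v)\<in>E. f u v) = (\<Sum>u\<in>V. \<Sum>v\<in>E `` {u}. f u v)"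
proof -
  have "E = Sigma V (\<lambda>u. E `` {u})" using E_subset by auto
  then show ?thesis
    using sum.Sigma[of V "\<lambda>u. E `` {u}" f] finite_V by simp
qed

lemma sum_arcs_swap: "(\<Sum>(u, v)\<in>E. f u v) = (\<Sum>(u, v)\<in>E. f v u)"
  by (rule sum.reindex_bij_witness[of _ prod.swap prod.swap]) (auto simp: E_iff)

lemma sum_arcs_bilinear:
  "(\<Sum>(u, v)\<in>E. (x u + x v) * (z u + z v)) = 2 * (\<Sum>v\<in>V. z v * qop E x v)"
proof -
  have "(\<Sum>(u, v)\<in>E. (x u + x v) * (z u + z v)) =
      (\<Sum>(u, v)\<in>E. (x u + x v) * z u) + (\<Sum>(u, v)\<in>E. (x u + x v) * z v)"
    unfolding sum.distrib[symmetric] case_prod_unfold by (intro sum.cong) (auto simp: algebra_simps)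
  also have "(\<Sum>(u, v)\<in>E. (x u + x v) * z v) = (\<Sum>(u, v)\<in>E. (x u + x v) * z u)"
    by (subst sum_arcs_swap) (simp add: add.commute)
  also have "(\<Sum>(u, v)\<in>E. (x u + x v) * z u) = (\<Sum>v\<in>V. z v * qop E x v)"
    by (simp only: sum_arcs qop_def sum_distrib_left mult.commute)
  finally show ?thesis by simp
qed

lemma qform_eq: "qform E x = 2 * (\<Sum>v\<in>V. x v * qop E x v)"
  using sum_arcs_bilinear[of x x] by (simp add: qform_def power2_eq_square)

lemma qform_eigen:
  assumes "\<And>v. v \<in> V \<Longrightarrow> qop E x v = c * x v"
  shows "qform E x = 2 * c * (\<Sum>v\<in>V. (x v)\<^sup>2)"
  using assms by (simp add: qform_eq sum_distrib_left power2_eq_square mult_ac)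

lemma qform_cong: "(\<And>v. v \<in> V \<Longrightarrow> x v = y v) \<Longrightarrow> qform E x = qform E y"
  unfolding qform_def using E_subset by (intro sum.cong) auto

lemma qform_maximizer:
  assumes "V \<noteq> {}"
  obtains x where "(\<Sum>v\<in>V. (x v)\<^sup>2) = 1"
    and "\<And>y. (\<Sum>v\<in>V. (y v)\<^sup>2) = 1 \<Longrightarrow> qform E y \<le> qform E x"
proof -
  \<comment> \<open>Entries outside \<open>V\<close> are pinned to 0, which keeps the cube compact
    in the product topology on all functions.\<close>
  define B where "B = (\<Pi>\<^sub>E v\<in>UNIV. if v \<in> V then {-1..1::real} else {0})"
  have cB: "compact B"
  proof -
    have "compactin (product_topology (\<lambda>_. euclidean) UNIV) B"
      unfolding B_def compactin_PiE by auto
    then show ?thesis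
      by (simp add: euclidean_product_topology)
  qed
  define K where "K = B \<inter> {x. (\<Sum>v\<in>V. (x v)\<^sup>2) = 1}"
  have "closed {x :: 'a \<Rightarrow> real. (\<Sum>v\<in>V. (x v)\<^sup>2) = 1}"
    by (intro closed_Collect_eq continuous_intros continuous_on_product_coordinates)
  then have cK: "compact K"
    unfolding K_def using cB by (metis compact_Int_closed)
  obtain a where a: "a \<in> V" using assms by auto
  have "(\<lambda>v. if v = a then 1 else 0) \<in> K"
    using a finite_V by (auto simp: K_def B_def if_distrib[of "\<lambda>x. x\<^sup>2"] sum.delta cong: if_cong)
  then have "K \<noteq> {}" by blast
  moreover have "continuous_on K (qform E)"
    unfolding qform_def case_prod_unfold
    by (intro continuous_intros continuous_on_subset[OF continuous_on_product_coordinates]) auto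
  ultimately obtain x where x: "x \<in> K" "\<And>y. y \<in> K \<Longrightarrow> qform E y \<le> qform E x"
    using continuous_attains_sup[OF cK] by blast
  show ?thesis
  proof (rule that[of x])
    fix y :: "'a \<Rightarrow> real" assume y: "(\<Sum>v\<in>V. (y v)\<^sup>2) = 1"
    define y' where "y' = (\<lambda>v. if v \<in> V then y v else 0)"
    have "\<bar>y v\<bar> \<le> 1" if "v \<in> V" for v
    proof -
      have "(y v)\<^sup>2 \<le> 1"
        using member_le_sum[of v V "\<lambda>v. (y v)\<^sup>2"] that finite_V y by simp
      then show ?thesis by (simp add: abs_square_le_1)
    qed
    then have "y' \<in> K"
      using y by (auto simp: K_def B_def y'_def abs_le_iff)
    moreover have "qform E y' = qform E y"
      by (rule qform_cong) (simp add: y'_def)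
    ultimately show "qform E y \<le> qform E x" using x(2) by metis
  qed (use x(1) in \<open>simp add: K_def\<close>)
qed

lemma qform_scale: "qform E (\<lambda>v. c * x v) = c\<^sup>2 * qform E x"
  by (simp add: qform_def sum_distrib_left case_prod_unfold power_mult_distrib[symmetric] distrib_left)

lemma qform_add: "qform E (\<lambda>v. x v + t * z v) =
    qform E x + 4 * t * (\<Sum>v\<in>V. z v * qop E x v) + t\<^sup>2 * qform E z"
proof -
  have "qform E (\<lambda>v. x v + t * z v) =
      qform E x + 2 * t * (\<Sum>(u, v)\<in>E. (x u + x v) * (z u + z v)) + t\<^sup>2 * qform E z"
    unfolding qform_def sum_distrib_left case_prod_unfold sum.distrib[symmetric]
    by (intro sum.cong) (auto simp: power2_eq_square algebra_simps)
  then show ?thesis by (simp add: sum_arcs_bilinear)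
qed

text \<open>Absolute values do not lower the form, so a maximiser may be taken nonnegative.
  Perturbing one coordinate cannot raise the Rayleigh quotient, so the first variation vanishes,
  which is the eigenvalue equation.\<close>

lemma perron:
  assumes "V \<noteq> {}"
  obtains x q where "\<And>v. 0 \<le> x v" "(\<Sum>v\<in>V. (x v)\<^sup>2) = 1"
    "\<And>v. v \<in> V \<Longrightarrow> qop E x v = q * x v"
    "\<And>y. qform E y \<le> 2 * q * (\<Sum>v\<in>V. (y v)\<^sup>2)"
proof -
  obtain x0 where x0: "(\<Sum>v\<in>V. (x0 v)\<^sup>2) = 1"
    and max: "\<And>y. (\<Sum>v\<in>V. (y v)\<^sup>2) = 1 \<Longrightarrow> qform E y \<le> qform E x0"
    using qform_maximizer[OF assms] by blast
  define x where "x = (\<lambda>v. \<bar>x0 v\<bar>)"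
  define q where "q = qform E x0 / 2"
  have x1: "(\<Sum>v\<in>V. (x v)\<^sup>2) = 1" using x0 by (simp add: x_def)
  have "qform E x0 \<le> qform E x"
    unfolding qform_def case_prod_unfold x_def
    by (intro sum_mono) (simp add: abs_le_square_iff[symmetric] abs_triangle_ineq)
  with max[OF x1] have qx: "qform E x = 2 * q" by (simp add: q_def)
  have le: "qform E y \<le> 2 * q * (\<Sum>v\<in>V. (y v)\<^sup>2)" for y
  proof (cases "(\<Sum>v\<in>V. (y v)\<^sup>2) = 0")
    case True
    then have "y v = 0" if "v \<in> V" for v
      using that finite_V by (simp add: sum_nonneg_eq_0_iff)
    then have "qform E y = qform E (\<lambda>v. 0)" by (intro qform_cong) simp
    then show ?thesis using True by (simp add: qform_def)
  next
    case False
    define N where "N = (\<Sum>v\<in>V. (y v)\<^sup>2)"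
    have N: "N > 0" using False by (simp add: N_def sum_nonneg less_le)
    define c where "c = 1 / sqrt N"
    have c2: "c\<^sup>2 = 1 / N" using N by (simp add: c_def power_divide)
    have "(\<Sum>v\<in>V. (c * y v)\<^sup>2) = c\<^sup>2 * N"
      by (simp only: power_mult_distrib sum_distrib_left N_def)
    then have "(\<Sum>v\<in>V. (c * y v)\<^sup>2) = 1"
      using N by (simp add: c2)
    from max[OF this] have "c\<^sup>2 * qform E y \<le> 2 * q" by (simp add: qform_scale q_def)
    then show ?thesis using N by (simp add: c2 field_simps flip: N_def)
  qed
  have "qop E x w = q * x w" if w: "w \<in> V" for w
  proof -
    define z where "z = (\<lambda>v. if v = w then 1 else 0 :: real)"
    define b where "b = q * x w - qop E x w"
    define C where "C = 2 * q - qform E z"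
    have zs: "(\<Sum>v\<in>V. z v * f v) = f w" "(\<Sum>v\<in>V. (z v)\<^sup>2) = 1" for f
      using w finite_V by (auto simp: z_def if_distrib[of "\<lambda>x. x\<^sup>2"] if_distrib[of "\<lambda>x. x * _"] cong: if_cong)
    have pos: "0 \<le> 4 * t * b + t\<^sup>2 * C" for t
    proof -
      have "(\<Sum>v\<in>V. (x v + t * z v)\<^sup>2) = (\<Sum>v\<in>V. (x v)\<^sup>2) + 2 * t * (\<Sum>v\<in>V. z v * x v) + t\<^sup>2 * (\<Sum>v\<in>V. (z v)\<^sup>2)"
        unfolding sum_distrib_left sum.distrib[symmetric]
        by (intro sum.cong) (auto simp: power2_eq_square algebra_simps)
      then have "(\<Sum>v\<in>V. (x v + t * z v)\<^sup>2) = 1 + 2 * t * x w + t\<^sup>2" by (simp add: zs x1)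
      with le[of "\<lambda>v. x v + t * z v"] show ?thesis
        by (simp add: qform_add zs qx b_def C_def algebra_simps)
    qed
    have "b = 0"
    proof (rule ccontr)
      assume b: "b \<noteq> 0"
      \<comment> \<open>At \<open>t = - b / D\<close> the linear term is
        \<open>- 4 * b^2 / D\<close>, the quadratic one at most \<open>b^2 / D\<close>.\<close>
      define D where "D = \<bar>C\<bar> + 1"
      have D: "D > 0" "C \<le> D" by (auto simp: D_def)
      have "0 \<le> 4 * (- b / D) * b + (- b / D)\<^sup>2 * C" by (rule pos)
      also have "\<dots> \<le> 4 * (- b / D) * b + (- b / D)\<^sup>2 * D" using D by (intro add_left_mono mult_left_mono) auto
      also have "\<dots> = - 3 * b\<^sup>2 / D" using D by (simp add: field_simps power2_eq_square)
      also have "\<dots> < 0" using b D by (simp add: divide_less_0_iff)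
      finally show False by simp
    qed
    then show ?thesis by (simp add: b_def)
  qed
  with that[of x q] show ?thesis using x1 le by (auto simp: x_def)
qed

end

section \<open>From the matrix spectrum to eigenfunctions on the vertex set\<close>

lemma finite_graph_pair_graph:
  assumes "pair_graph G" shows "finite_graph (pverts G) (parcs G)"
proof -
  interpret pair_graph G by fact
  show ?thesis
    using pair_finite_verts arcs_symmetric in_arcsD1 in_arcsD2
    by unfold_locales (auto intro!: symI)
qed

lemma out_degree_with_proj: "out_degree (with_proj G) v = card (parcs G `` {v})"
proof -
  have "out_arcs (with_proj G) v = Pair v ` (parcs G `` {v})"
    by (auto simp: out_arcs_def)
  then show ?thesis by (simp add: out_degree_def card_image inj_on_def)
qed

lemma sum_nth_distinct:
  assumes "distinct vs"
  shows "(\<Sum>j<length vs. f (vs ! j)) = (\<Sum>v\<in>set vs. f v)"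
  using sum.reindex_bij_betw[OF bij_betw_nth[OF assms, of "{..<length vs}" "set vs"]] by simp

lemma signless_laplacian_mult:
  assumes "pair_graph G" and vs: "distinct vs" "set vs = pverts G" and i: "i < length vs"
  shows "(signless_laplacian G vs *\<^sub>v vec (length vs) (\<lambda>j. x (vs ! j))) $ i = qop (parcs G) x (vs ! i)"
proof -
  interpret finite_graph "pverts G" "parcs G" using assms(1) by (rule finite_graph_pair_graph)
  let ?v = "vs ! i" and ?E = "parcs G"
  have "(signless_laplacian G vs *\<^sub>v vec (length vs) (\<lambda>j. x (vs ! j))) $ i =
      (\<Sum>j<length vs. signless_laplacian G vs $$ (i, j) * x (vs ! j))"
    using i signless_laplacian_carrier[of G vs]
    by (auto simp: scalar_prod_def atLeast0LessThan intro!: sum.cong)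
  also have "\<dots> = (\<Sum>j<length vs. (\<lambda>u. ((if ?v = u then real (card (?E `` {?v})) else 0) +
      (if (?v, u) \<in> ?E then 1 else 0)) * x u) (vs ! j))"
    using i vs by (intro sum.cong)
      (auto simp: signless_laplacian_index nth_eq_iff_index_eq out_degree_with_proj)
  also have "\<dots> = (\<Sum>u\<in>pverts G. ((if ?v = u then real (card (?E `` {?v})) else 0) +
      (if (?v, u) \<in> ?E then 1 else 0)) * x u)"
    by (subst sum_nth_distinct[OF vs(1)]) (simp add: vs(2))
  also have "\<dots> = real (card (?E `` {?v})) * x ?v + (\<Sum>u\<in>pverts G. (if (?v, u) \<in> ?E then x u else 0))"
    using i vs finite_V by (simp add: distrib_right sum.distrib if_distrib[of "\<lambda>a. a * _"] cong: if_cong)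
       (use nth_mem[OF i] in auto)
  also have "(\<Sum>u\<in>pverts G. (if (?v, u) \<in> ?E then x u else 0)) = (\<Sum>u\<in>?E `` {?v}. x u)"
    using finite_V Image_subset[of "{?v}"] by (intro sum.mono_neutral_cong_right) auto
  finally show ?thesis by (simp add: qop_def sum.distrib)
qed

lemma spectrum_signless_laplacian_iff:
  assumes "pair_graph G" and vs: "distinct vs" "set vs = pverts G"
  shows "c \<in> spectrum (signless_laplacian G vs) \<longleftrightarrow>
    (\<exists>x. (\<exists>v\<in>pverts G. x v \<noteq> 0) \<and> (\<forall>v\<in>pverts G. qop (parcs G) x v = c * x v))"
proof
  assume "c \<in> spectrum (signless_laplacian G vs)"
  then obtain y where y: "y \<in> carrier_vec (length vs)" "y \<noteq> 0\<^sub>v (length vs)"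
    "signless_laplacian G vs *\<^sub>v y = c \<cdot>\<^sub>v y"
    using signless_laplacian_carrier[of G vs]
    by (auto simp: spectrum_def eigenvalue_def eigenvector_def)
  define x where "x = (\<lambda>v. y $ (THE i. i < length vs \<and> vs ! i = v))"
  have x: "x (vs ! i) = y $ i" if "i < length vs" for i
  proof -
    have "(THE j. j < length vs \<and> vs ! j = vs ! i) = i"
      using that vs(1) by (intro the_equality) (auto simp: nth_eq_iff_index_eq)
    then show ?thesis by (simp add: x_def)
  qed
  have yv: "y = vec (length vs) (\<lambda>j. x (vs ! j))"
    using y(1) x by (intro eq_vecI) auto
  obtain i where i: "i < length vs" "y $ i \<noteq> 0"
    using y(1,2) by (metis carrier_vecD eq_vecI index_zero_vec)
  show "\<exists>x. (\<exists>v\<in>pverts G. x v \<noteq> 0) \<and> (\<forall>v\<in>pverts G. qop (parcs G) x v = c * x v)"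
  proof (intro exI[of _ x] conjI ballI)
    show "\<exists>v\<in>pverts G. x v \<noteq> 0" using i x vs(2) by (metis nth_mem)
    fix v assume "v \<in> pverts G"
    then obtain j where j: "j < length vs" "v = vs ! j" using vs(2) by (metis in_set_conv_nth)
    have "qop (parcs G) x v = (signless_laplacian G vs *\<^sub>v y) $ j"
      using signless_laplacian_mult[OF assms j(1), of x] j yv by simp
    also have "\<dots> = c * x v" using y(1) j x by (simp add: y(3))
    finally show "qop (parcs G) x v = c * x v" .
  qed
next
  assume "\<exists>x. (\<exists>v\<in>pverts G. x v \<noteq> 0) \<and> (\<forall>v\<in>pverts G. qop (parcs G) x v = c * x v)"
  then obtain x v where x: "v \<in> pverts G" "x v \<noteq> 0" "\<And>v. v \<in> pverts G \<Longrightarrow> qop (parcs G) x v = c * x v"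
    by blast
  let ?y = "vec (length vs) (\<lambda>j. x (vs ! j))"
  obtain j where j: "j < length vs" "v = vs ! j" using x(1) vs(2) by (metis in_set_conv_nth)
  have "?y \<noteq> 0\<^sub>v (length vs)"
  proof
    assume "?y = 0\<^sub>v (length vs)"
    then have "?y $ j = 0" using j by simp
    then show False using j x(2) by simp
  qed
  moreover have "signless_laplacian G vs *\<^sub>v ?y = c \<cdot>\<^sub>v ?y"
    using signless_laplacian_carrier[of G vs] signless_laplacian_mult[OF assms] x(3) vs(2)
    by (intro eq_vecI) (auto dest: nth_mem)
  ultimately show "c \<in> spectrum (signless_laplacian G vs)"
    using signless_laplacian_carrier[of G vs]
    by (auto simp: spectrum_def eigenvalue_def eigenvector_def intro!: exI[of _ ?y])
qed

text \<open>The \<open>q\<close> of \<open>perron\<close> is an eigenvalue; by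
  \<open>qform_eigen\<close> and the Rayleigh bound no other eigenvalue exceeds it.\<close>

lemma q_index_perron:
  assumes G: "pair_graph G" and ne: "pverts G \<noteq> {}"
  obtains x where "\<And>v. 0 \<le> x v" "(\<Sum>v\<in>pverts G. (x v)\<^sup>2) = 1"
    "\<And>v. v \<in> pverts G \<Longrightarrow> qop (parcs G) x v = q_index G * x v"
    "\<And>y. qform (parcs G) y \<le> 2 * q_index G * (\<Sum>v\<in>pverts G. (y v)\<^sup>2)"
proof -
  interpret finite_graph "pverts G" "parcs G" using G by (rule finite_graph_pair_graph)
  obtain x q where x: "\<And>v. 0 \<le> x v" "(\<Sum>v\<in>pverts G. (x v)\<^sup>2) = 1"
    "\<And>v. v \<in> pverts G \<Longrightarrow> qop (parcs G) x v = q * x v"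
    "\<And>y. qform (parcs G) y \<le> 2 * q * (\<Sum>v\<in>pverts G. (y v)\<^sup>2)"
    using perron[OF ne] by blast
  obtain vs where vs: "distinct vs" "set vs = pverts G"
    using finite_V finite_distinct_list by metis
  have "Max (spectrum (signless_laplacian G vs)) = q"
  proof (rule Max_eqI)
    show "finite (spectrum (signless_laplacian G vs))"
      using card_finite_spectrum(1)[OF signless_laplacian_carrier] .
    have "\<exists>v\<in>pverts G. x v \<noteq> 0"
    proof (rule ccontr)
      assume "\<not> ?thesis"
      then have "(\<Sum>v\<in>pverts G. (x v)\<^sup>2) = 0" by (intro sum.neutral) auto
      then show False using x(2) by simp
    qed
    then show "q \<in> spectrum (signless_laplacian G vs)"
      using x(3) by (auto simp: spectrum_signless_laplacian_iff[OF G vs])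
    fix c assume "c \<in> spectrum (signless_laplacian G vs)"
    then obtain y v where y: "v \<in> pverts G" "y v \<noteq> 0"
        "\<And>v. v \<in> pverts G \<Longrightarrow> qop (parcs G) y v = c * y v"
      by (auto simp: spectrum_signless_laplacian_iff[OF G vs])
    have "(\<Sum>v\<in>pverts G. (y v)\<^sup>2) > 0"
      using y finite_V by (intro sum_pos2[of _ v]) auto
    with x(4)[of y] qform_eigen[OF y(3)] show "c \<le> q" by simp
  qed
  then have "q_index G = q" using q_index_eq[OF vs] by simp
  then show ?thesis using that x by blast
qed

section \<open>Graphs without long paths\<close>

text \<open>\<open>length p\<close> counts vertices. Only arcs tie a path to the graph, so
  \<open>[v]\<close> is a path for every \<open>v\<close>.\<close>

definition is_path :: "'a rel \<Rightarrow> 'a list \<Rightarrow> bool" where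
  "is_path E p \<longleftrightarrow> distinct p \<and> successively (\<lambda>u v. (u, v) \<in> E) p"

lemma is_path_singleton [simp]: "is_path E [v]"
  by (simp add: is_path_def)

lemma is_path_Cons:
  "p \<noteq> [] \<Longrightarrow> is_path E (v # p) \<longleftrightarrow> is_path E p \<and> v \<notin> set p \<and> (v, hd p) \<in> E"
  by (auto simp: is_path_def successively_Cons)

lemma pcas_zip: "pcas u (zip (u # p) (p @ [w])) w"
  by (induction p arbitrary: u) auto

lemma pawalk_verts_zip: "pawalk_verts u (zip (u # p) (p @ [w])) = u # p @ [w]"
  by (induction p arbitrary: u) auto

lemma set_zip_successively:
  "successively (\<lambda>u v. (u, v) \<in> E) (u # p @ [w]) \<Longrightarrow> set (zip (u # p) (p @ [w])) \<subseteq> E"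
  by (induction p arbitrary: u) (auto simp: successively_Cons)

lemma cycle_through_hub:
  assumes "is_path (parcs G) p" "p \<noteq> []" "w \<in> pverts G" "w \<notin> set p"
    and "(w, hd p) \<in> parcs G" "(last p, w) \<in> parcs G"
  shows "\<exists>c. pre_digraph.cycle (with_proj G) c \<and> length c = length p + 1"
proof (intro exI conjI)
  let ?c = "zip (w # p) (p @ [w])"
  have "successively (\<lambda>u v. (u, v) \<in> parcs G) (w # p @ [w])"
    using assms by (auto simp: is_path_def successively_Cons successively_append_iff)
  then have "set ?c \<subseteq> parcs G" by (rule set_zip_successively)
  then show "pre_digraph.cycle (with_proj G) ?c"
    using assms unfolding pre_digraph.cycle_def pre_digraph.awalk_def
    by (intro exI[of _ w])
      (auto simp: cas_with_proj_eq awalk_verts_with_proj_eq pcas_zip pawalk_verts_zip is_path_def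
         simp del: zip_Cons_Cons zip_Cons)
qed simp

context finite_graph
begin

text \<open>Greedy extension at the head: its at least \<open>d\<close> neighbours in
  \<open>W\<close> cannot all lie among the at most \<open>j < d\<close> vertices behind it.\<close>

lemma path_min_degree:
  assumes "irrefl E" "W \<noteq> {}" "finite W"
    and "\<And>v. v \<in> W \<Longrightarrow> d \<le> card (E `` {v} \<inter> W)" and "j \<le> d"
  shows "\<exists>p. is_path E p \<and> length p = Suc j \<and> set p \<subseteq> W"
  using \<open>j \<le> d\<close>
proof (induction j)
  case 0
  obtain v where "v \<in> W" using assms(2) by blast
  then show ?case by (intro exI[of _ "[v]"]) simp
next
  case (Suc j)
  then obtain p where p: "is_path E p" "length p = Suc j" "set p \<subseteq> W" by auto
  then obtain v q where vq: "p = v # q" by (cases p) auto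
  have "card (set q) \<le> j" using p(2) vq card_length[of q] by simp
  also have "\<dots> < d" using Suc.prems by simp
  also have "d \<le> card (E `` {v} \<inter> W)" using p vq by (intro assms(4)) auto
  finally obtain u where u: "u \<in> E `` {v} \<inter> W" "u \<notin> set q"
    by (metis List.finite_set card_mono not_le subsetI)
  moreover have "u \<noteq> v" using u assms(1) by (auto simp: irrefl_def)
  ultimately show ?case using p vq
    by (intro exI[of _ "u # p"]) (auto simp: is_path_Cons E_iff)
qed

lemma card_arcs_remove:
  assumes "irrefl E" "v \<in> W" "finite W"
  shows "card (E \<inter> W \<times> W) = card (E \<inter> (W - {v}) \<times> (W - {v})) + 2 * card (E `` {v} \<inter> W)"
proof -
  let ?N = "E `` {v} \<inter> W"
  have N: "finite ?N" "v \<notin> ?N" using assms by (auto simp: irrefl_def)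
  have fin: "finite (E \<inter> X)" for X using finite_E by simp
  have "E \<inter> W \<times> W = (E \<inter> (W - {v}) \<times> (W - {v})) \<union> ({v} \<times> ?N \<union> ?N \<times> {v})"
    using assms E_iff by auto
  also have "card \<dots> = card (E \<inter> (W - {v}) \<times> (W - {v})) + card ({v} \<times> ?N \<union> ?N \<times> {v})"
    using N fin by (intro card_Un_disjoint) auto
  also have "card ({v} \<times> ?N \<union> ?N \<times> {v}) = card ({v} \<times> ?N) + card (?N \<times> {v})"
    using N by (intro card_Un_disjoint) auto
  finally show ?thesis by (simp add: card_cartesian_product)
qed

text \<open>A weak Erdos-Gallai bound: some vertex has at most \<open>d\<close> neighbours in
  \<open>W\<close>, else \<open>path_min_degree\<close> applies with \<open>d + 1\<close>; deleting
  it removes at most \<open>2 * d\<close> arcs.\<close>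

lemma card_arcs_le_of_no_path:
  assumes "irrefl E" "\<nexists>p. is_path E p \<and> length p = d + 2" "finite W"
  shows "card (E \<inter> W \<times> W) \<le> 2 * d * card W"
  using \<open>finite W\<close>
proof (induction "card W" arbitrary: W)
  case 0
  then show ?case by simp
next
  case (Suc c)
  have "W \<noteq> {}" using Suc by auto
  then obtain v where v: "v \<in> W" "card (E `` {v} \<inter> W) \<le> d"
    using path_min_degree[OF assms(1) _ Suc.prems, of "Suc d" "Suc d"] assms(2)
    by (metis add_2_eq_Suc' le_refl not_less_eq_eq)
  have "card (E \<inter> (W - {v}) \<times> (W - {v})) \<le> 2 * d * card (W - {v})"
    using Suc v by (intro Suc.hyps(1)) auto
  moreover have "card W = Suc (card (W - {v}))" using v Suc.prems by (metis card_Suc_Diff1)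
  ultimately show ?case
    using card_arcs_remove[OF assms(1) v(1) Suc.prems] v(2) by simp
qed

lemma card_E: "card E = (\<Sum>v\<in>V. card (E `` {v}))"
proof -
  have "E = Sigma V (\<lambda>u. E `` {u})" using E_subset by auto
  then show ?thesis using card_SigmaI[of V "\<lambda>u. E `` {u}"] finite_V by simp
qed

text \<open>The path grows at its head by two vertices at a time: the next \<open>a\<close> of the
  list, then a fresh common neighbour \<open>b\<close> of \<open>a\<close> and its successor in the
  list. Fewer than \<open>N\<close> vertices are forbidden for \<open>b\<close>.\<close>

lemma path_alternating:
  assumes "is_path E p" "p \<noteq> []" "distinct as" "set as \<inter> set p = {}"
    and "as \<noteq> [] \<Longrightarrow> (hd as, hd p) \<in> E"
    and "\<And>a a'. a \<in> set as \<Longrightarrow> a' \<in> set as \<Longrightarrow> N \<le> card (E `` {a} \<inter> E `` {a'})"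
    and "length p + 2 * length as \<le> N"
  shows "\<exists>p'. is_path E p' \<and> length p' = length p + 2 * length as"
  using assms
proof (induction as arbitrary: p)
  case Nil
  then show ?case by auto
next
  case (Cons a as)
  \<comment> \<open>The last vertex of the list has no successor; there \<open>b\<close> is just any
    fresh neighbour of \<open>a\<close>.\<close>
  define a' where "a' = (if as = [] then a else hd as)"
  have a': "a' \<in> set (a # as)" by (auto simp: a'_def)
  have "card (set p \<union> set (a # as)) \<le> length p + length (a # as)"
    by (metis card_Un_le card_length add_mono le_trans)
  also have "\<dots> < N" using Cons.prems(7) by simp
  also have "N \<le> card (E `` {a} \<inter> E `` {a'})" using a' by (intro Cons.prems(6)) auto
  finally obtain b where b: "(a, b) \<in> E" "(a', b) \<in> E" "b \<notin> set p \<union> set (a # as)"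
    by (metis IntD1 IntD2 Image_singleton_iff List.finite_set card_mono finite_Un not_le subsetI)
  have "\<exists>p'. is_path E p' \<and> length p' = length (b # a # p) + 2 * length as"
  proof (rule Cons.IH)
    show "is_path E (b # a # p)"
      using Cons.prems b by (auto simp: is_path_Cons E_iff)
    show "(hd as, hd (b # a # p)) \<in> E" if "as \<noteq> []"
      using b that by (simp add: a'_def)
  qed (use Cons.prems b in auto)
  then show ?case by simp
qed

end

section \<open>Configurations excluded around a set of large codegrees\<close>

locale long_path_free = finite_graph +
  fixes A :: "'a set" and k :: nat
  assumes irrefl_E: "irrefl E"
    and no_path: "\<nexists>p. is_path E p \<and> length p = 2 * k + 1"
    and A_subset: "A \<subseteq> V"
    and codegree: "\<And>a a'. a \<in> A \<Longrightarrow> a' \<in> A \<Longrightarrow> 2 * k + 1 \<le> card (E `` {a} \<inter> E `` {a'})"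
begin

lemma finite_A: "finite A"
  using A_subset finite_V finite_subset by blast

text \<open>Used with start paths on 1, 3 and 5 vertices together with \<open>k\<close>,
  \<open>k - 1\<close> and \<open>k - 2\<close> vertices of \<open>A\<close>, each time giving
  \<open>2 * k + 1\<close> vertices.\<close>

lemma no_alternating:
  assumes "is_path E p" "p \<noteq> []" "distinct as" "set as \<subseteq> A" "set as \<inter> set p = {}"
    and "as \<noteq> [] \<Longrightarrow> (hd as, hd p) \<in> E"
  shows "length p + 2 * length as \<noteq> 2 * k + 1"
proof
  assume len: "length p + 2 * length as = 2 * k + 1"
  have "\<exists>p'. is_path E p' \<and> length p' = length p + 2 * length as"
  proof (rule path_alternating[OF assms(1-3,5,6)])
    show "2 * k + 1 \<le> card (E `` {a} \<inter> E `` {a'})" if "a \<in> set as" "a' \<in> set as" for a a'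
      using that assms(4) by (intro codegree) auto
  qed (use len in auto)
  then show False using no_path len by auto
qed

text \<open>Otherwise \<open>k\<close> vertices of \<open>A\<close> and a start vertex adjacent to
  the first of them give an alternating path; the case \<open>a = a'\<close> of
  \<open>codegree\<close> provides the start vertex.\<close>

lemma card_A_less:
  assumes "k \<ge> 1" shows "card A < k"
proof (rule ccontr)
  assume "\<not> card A < k"
  then obtain A' where A': "A' \<subseteq> A" "card A' = k" "finite A'"
    by (metis not_le obtain_subset_with_card_n linorder_not_less)
  then obtain as where as: "set as = A'" "distinct as"
    using finite_distinct_list by blast
  have len: "length as = k" using as A' distinct_card by fastforce
  then have ne: "as \<noteq> []" using assms by auto
  have "card (set as) < card (E `` {hd as})"
    using codegree[of "hd as" "hd as"] as A' len ne hd_in_set[OF ne] by auto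
  then obtain b where b: "(hd as, b) \<in> E" "b \<notin> set as"
    by (metis Image_singleton_iff List.finite_set card_mono not_le subsetI)
  then show False
    using no_alternating[of "[b]" as] as A' len by auto
qed

context
  assumes card_A: "card A + 1 = k"
begin

text \<open>All \<open>k - 1\<close> vertices of \<open>A\<close> attach to the three-vertex path,
  with \<open>a\<close> first because of its edge to the end \<open>b\<close>.\<close>

lemma no_P3:
  assumes "(b, c) \<in> E" "(c, b') \<in> E" "b \<noteq> b'" "a \<in> A" "(a, b) \<in> E"
    and "b \<notin> A" "c \<notin> A" "b' \<notin> A"
  shows False
proof -
  obtain as where as: "set as = A - {a}" "distinct as"
    using finite_distinct_list finite_A by (metis finite_Diff)
  have len: "length (a # as) + 1 = k"
    using distinct_card[OF as(2)] as(1) card_A finite_A assms(4)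
    by (metis card.remove length_Cons)
  have "is_path E [b, c, b']"
    using assms irrefl_E by (auto simp: is_path_def irrefl_def)
  moreover have "distinct (a # as)" "set (a # as) \<subseteq> A" "set (a # as) \<inter> set [b, c, b'] = {}"
    using as assms by auto
  ultimately show False
    using no_alternating[of "[b, c, b']" "a # as"] assms(5) len by auto
qed

text \<open>Two disjoint edges joined through one \<open>a\<close> make a path on five vertices; the
  other \<open>k - 2\<close> vertices of \<open>A\<close> extend it to
  \<open>2 * k + 1\<close>.\<close>

lemma no_2P2:
  assumes "(b, b') \<in> E" "(c, c') \<in> E" "distinct [b, b', c, c']" "A \<noteq> {}"
    and "{b, b', c, c'} \<inter> A = {}"
    and "\<And>a v. a \<in> A \<Longrightarrow> v \<in> {b, b', c, c'} \<Longrightarrow> (a, v) \<in> E"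
  shows False
proof -
  obtain a where a: "a \<in> A" using assms by blast
  obtain as where as: "set as = A - {a}" "distinct as"
    using finite_distinct_list finite_A by (metis finite_Diff)
  have len: "length (a # as) + 1 = k"
    using distinct_card[OF as(2)] as(1) card_A finite_A a
    by (metis card.remove length_Cons)
  have "is_path E [c, c', a, b, b']"
    using assms a E_iff by (auto simp: is_path_def)
  moreover have "set as \<subseteq> A" "set as \<inter> set [c, c', a, b, b'] = {}"
    using as assms by auto
  moreover have "(hd as, c) \<in> E" if "as \<noteq> []"
    using that as assms(6) hd_in_set[of as] by auto
  ultimately show False
    using no_alternating[of "[c, c', a, b, b']" as] as len by auto
qed

text \<open>By \<open>no_P3\<close>, an arc outside \<open>A\<close> with one end adjacent to
  \<open>a\<close> is determined by its other end, so there are at most \<open>card V\<close> in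
  each direction. The other arcs join non-neighbours of \<open>a\<close>.\<close>

lemma card_arcs_rest:
  assumes "a \<in> A"
  shows "card (E \<inter> (V - A) \<times> (V - A)) \<le> 2 * card V + (card (V - A - E `` {a}))\<^sup>2"
proof -
  let ?B = "V - A" and ?N = "E `` {a} \<inter> (V - A)" and ?R = "V - A - E `` {a}"
  have fin: "finite V" "finite ?R" "finite E" using finite_V finite_E by auto
  define F1 where "F1 = {(u, v). (u, v) \<in> E \<inter> ?B \<times> ?B \<and> u \<in> ?N}"
  define F2 where "F2 = {(u, v). (u, v) \<in> E \<inter> ?B \<times> ?B \<and> v \<in> ?N}"
  have "inj_on snd F1"
  proof (intro inj_onI)
    fix e f assume "e \<in> F1" "f \<in> F1" "snd e = snd f"
    then have "fst e = fst f"
      using no_P3[of "fst e" "snd e" "fst f" a] assms E_iff[of "fst f" "snd f"] unfolding F1_def by fastforce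
    with \<open>snd e = snd f\<close> show "e = f" by (simp add: prod_eq_iff)
  qed
  moreover have "snd ` F1 \<subseteq> V" by (auto simp: F1_def)
  ultimately have c1: "card F1 \<le> card V" using fin(1) by (metis card_inj_on_le)
  have "inj_on fst F2"
  proof (intro inj_onI)
    fix e f assume "e \<in> F2" "f \<in> F2" "fst e = fst f"
    then have "snd e = snd f"
      using no_P3[of "snd e" "fst e" "snd f" a] assms E_iff[of "fst e" "snd e"] unfolding F2_def by fastforce
    with \<open>fst e = fst f\<close> show "e = f" by (simp add: prod_eq_iff)
  qed
  moreover have "fst ` F2 \<subseteq> V" by (auto simp: F2_def)
  ultimately have c2: "card F2 \<le> card V" using fin(1) by (metis card_inj_on_le)
  have "finite F1" "finite F2"
    using fin(3) by (auto simp: F1_def F2_def intro: finite_subset)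
  then have "card (E \<inter> ?B \<times> ?B) \<le> card (F1 \<union> F2 \<union> ?R \<times> ?R)"
    using fin by (intro card_mono) (auto simp: F1_def F2_def)
  also have "\<dots> \<le> card F1 + card F2 + card (?R \<times> ?R)"
    using card_Un_le[of "F1 \<union> F2" "?R \<times> ?R"] card_Un_le[of F1 F2] by linarith
  finally show ?thesis using c1 c2 by (simp add: card_cartesian_product power2_eq_square)
qed

end

end

section \<open>The Perron vector around a dominating vertex\<close>

text \<open>Here \<open>(V, E)\<close> is a graph from which a dominating vertex has been deleted, \<open>x\<close> is the Perron
  vector scaled to be 1 at that vertex, and the eigenvalue is \<open>card V + S\<close> by the eigenvalue
  equation at that vertex.\<close>

locale perron_hub = finite_graph +
  fixes x :: "'a \<Rightarrow> real" and S :: real and k :: nat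
  assumes irrefl_E: "irrefl E"
    and no_path: "\<nexists>p. is_path E p \<and> length p = 2 * k + 1"
    and k_ge: "k \<ge> 2"
    and card_ge: "card V + 1 \<ge> 400 * k\<^sup>2"
    and x_nonneg: "\<And>v. 0 \<le> x v"
    and S_def: "S = (\<Sum>v\<in>V. x v)"
    and eigen: "\<And>v. v \<in> V \<Longrightarrow>
      (card V + S - 1 - card (E `` {v})) * x v = 1 + (\<Sum>u\<in>E `` {v}. x u)"
    and S_ge: "S \<ge> 2 * real k - 1 - 1 / 200"
begin

abbreviation "m \<equiv> real (card V)"
abbreviation "d v \<equiv> real (card (E `` {v}))"

lemma k_real: "real k \<ge> 2" using k_ge by simp

lemma m_ge: "m \<ge> 399 * real k ^ 2"
proof -
  have "real (card V + 1) \<ge> real (400 * k\<^sup>2)" using card_ge by (rule of_nat_mono)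
  moreover have "real k ^ 2 \<ge> 1" using k_ge by simp
  ultimately show ?thesis by simp
qed

lemma m_ge_k: "m \<ge> 798 * real k"
proof -
  have "real k * real k \<ge> 2 * real k" using k_real by (intro mult_right_mono) auto
  then show ?thesis using m_ge by (simp add: power2_eq_square)
qed

lemma degree_le: "v \<in> V \<Longrightarrow> d v \<le> m - 1"
proof -
  assume v: "v \<in> V"
  have "card (E `` {v}) \<le> card (V - {v})"
    using irrefl_E Image_subset finite_V by (intro card_mono) (auto simp: irrefl_def)
  moreover have "card V = Suc (card (V - {v}))"
    using v finite_V by (metis card_Suc_Diff1)
  ultimately show ?thesis by simp
qed

text \<open>The neighbour sum is at most \<open>S - x v\<close>; moving \<open>x v\<close> to the
  left absorbs the \<open>- 1\<close> of \<open>eigen\<close>.\<close>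

lemma weight_bound: "v \<in> V \<Longrightarrow> (m - d v + S) * x v \<le> 1 + S"
proof -
  assume v: "v \<in> V"
  have "(\<Sum>u\<in>E `` {v}. x u) \<le> (\<Sum>u\<in>V - {v}. x u)"
    using irrefl_E Image_subset finite_V x_nonneg by (intro sum_mono2) (auto simp: irrefl_def)
  also have "\<dots> = S - x v" using v finite_V by (simp add: S_def sum_diff1)
  finally show ?thesis using eigen[OF v] by (simp add: algebra_simps)
qed

lemma S_nonneg: "S \<ge> 0" using x_nonneg by (simp add: S_def sum_nonneg)

lemma weight_le_1:
  assumes "v \<in> V" shows "x v \<le> 1"
proof -
  have "(1 + S) * x v \<le> (m - d v + S) * x v"
    using degree_le[OF assms] x_nonneg by (intro mult_right_mono) auto
  also have "\<dots> \<le> (1 + S) * 1" using weight_bound[OF assms] by simp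
  finally show ?thesis using S_nonneg by (subst (asm) mult_le_cancel_left_pos) auto
qed

lemma weight_pos:
  assumes "v \<in> V" shows "x v > 0"
proof -
  have "1 + (\<Sum>u\<in>E `` {v}. x u) > 0" using x_nonneg by (simp add: add_pos_nonneg sum_nonneg)
  then have "x v \<noteq> 0" using eigen[OF assms] by auto
  then show ?thesis using x_nonneg[of v] by linarith
qed

lemma sum_identity: "(m + S - 1) * S = m + 2 * (\<Sum>v\<in>V. d v * x v)"
proof -
  have "(\<Sum>v\<in>V. \<Sum>u\<in>E `` {v}. x u) = (\<Sum>(v, u)\<in>E. x u)" by (rule sum_arcs[symmetric])
  also have "\<dots> = (\<Sum>(u, v)\<in>E. x u)" by (rule sum_arcs_swap)
  also have "\<dots> = (\<Sum>v\<in>V. d v * x v)" by (simp add: sum_arcs)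
  finally have *: "(\<Sum>v\<in>V. \<Sum>u\<in>E `` {v}. x u) = (\<Sum>v\<in>V. d v * x v)" .
  have "(m + S - 1) * S = (\<Sum>v\<in>V. (m + S - 1 - d v) * x v + d v * x v)"
    unfolding S_def sum_distrib_left by (intro sum.cong) (auto simp: algebra_simps)
  also have "\<dots> = (\<Sum>v\<in>V. 1 + (\<Sum>u\<in>E `` {v}. x u) + d v * x v)"
    by (intro sum.cong) (auto simp: eigen)
  also have "\<dots> = m + 2 * (\<Sum>v\<in>V. d v * x v)" by (simp add: sum.distrib *)
  finally show ?thesis .
qed

text \<open>The threshold 3/5 serves both sides: two vertices above it share more than
  \<open>m / 5\<close> neighbours, hence at least \<open>2 * k + 1\<close>; a vertex not above it
  has \<open>m - d v\<close> at least \<open>2 * m / 5\<close>, hence small weight.\<close>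

definition A :: "'a set" where "A = {v \<in> V. 5 * d v > 3 * m}"

sublocale long_path_free V E A k
proof
  show "irrefl E" by (rule irrefl_E)
  show "\<nexists>p. is_path E p \<and> length p = 2 * k + 1" by (rule no_path)
  show "A \<subseteq> V" by (auto simp: A_def)
  fix a a' assume aa: "a \<in> A" "a' \<in> A"
  have "card (E `` {a}) + card (E `` {a'}) = card (E `` {a} \<union> E `` {a'}) + card (E `` {a} \<inter> E `` {a'})"
    by (rule card_Un_Int) auto
  moreover have "card (E `` {a} \<union> E `` {a'}) \<le> card V"
    using Image_subset finite_V by (intro card_mono) auto
  ultimately have "d a + d a' \<le> m + real (card (E `` {a} \<inter> E `` {a'}))"
    by (metis add_right_mono of_nat_add of_nat_le_iff)
  moreover have "5 * d a > 3 * m" "5 * d a' > 3 * m" using aa by (auto simp: A_def)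
  ultimately have "real (2 * k + 1) \<le> real (card (E `` {a} \<inter> E `` {a'}))"
    using m_ge_k k_real by simp
  then show "2 * k + 1 \<le> card (E `` {a} \<inter> E `` {a'})" by (simp only: of_nat_le_iff)
qed

lemma weight_rest:
  assumes "v \<in> V - A" shows "x v \<le> 5 * (1 + S) / (2 * m)"
proof -
  have "2 * m / 5 * x v \<le> (m - d v + S) * x v"
    using assms x_nonneg S_nonneg by (intro mult_right_mono) (auto simp: A_def)
  also have "\<dots> \<le> 1 + S" using assms by (intro weight_bound) auto
  finally show ?thesis using m_ge_k k_real by (simp add: field_simps)
qed

lemma sum_degree_le: "(\<Sum>v\<in>V. d v) \<le> (4 * real k - 2) * m"
proof -
  \<comment> \<open>Here \<open>d = 2 * k - 1\<close>, so that \<open>d + 2\<close> is the forbidden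
    \<open>2 * k + 1\<close>.\<close>
  have "card (E \<inter> V \<times> V) \<le> 2 * (2 * k - 1) * card V"
    using no_path k_ge by (intro card_arcs_le_of_no_path irrefl_E finite_V) simp
  moreover have "E \<inter> V \<times> V = E" using E_subset by auto
  ultimately have "(\<Sum>v\<in>V. card (E `` {v})) \<le> 2 * (2 * k - 1) * card V" by (simp add: card_E)
  then have "real (\<Sum>v\<in>V. card (E `` {v})) \<le> real (2 * (2 * k - 1) * card V)" by (rule of_nat_mono)
  moreover have "real (2 * (2 * k - 1)) = 4 * real k - 2" using k_ge by (simp add: of_nat_diff)
  ultimately show ?thesis by simp
qed

definition T :: real where "T = (\<Sum>v\<in>A. x v)"

text \<open>Splits the sum in \<open>sum_identity\<close>: on \<open>A\<close> degrees are at most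
  \<open>m - 1\<close>; elsewhere \<open>weight_rest\<close> bounds the weights and
  \<open>sum_degree_le\<close> the degree sum, and \<open>m\<close> cancels. Terms with a factor
  \<open>S\<close> are collected on the left.\<close>

lemma S_T_bound: "S * (S + m - 20 * real k + 9) \<le> m + 2 * (m - 1) * T + 20 * real k - 10"
proof -
  have "(\<Sum>v\<in>V. d v * x v) = (\<Sum>v\<in>A. d v * x v) + (\<Sum>v\<in>V - A. d v * x v)"
    using sum.subset_diff[OF A_subset finite_V] by (simp add: add.commute)
  moreover have "(\<Sum>v\<in>A. d v * x v) \<le> (m - 1) * (\<Sum>v\<in>A. x v)"
    unfolding sum_distrib_left using A_subset x_nonneg degree_le
    by (intro sum_mono mult_right_mono) auto
  moreover have "(\<Sum>v\<in>V - A. d v * x v) \<le> (5 * real k - 5 / 2) * (2 * (1 + S))"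
  proof -
    have "(\<Sum>v\<in>V - A. d v * x v) \<le> (\<Sum>v\<in>V - A. d v * (5 * (1 + S) / (2 * m)))"
      using weight_rest by (intro sum_mono mult_left_mono) auto
    also have "\<dots> \<le> (\<Sum>v\<in>V. d v * (5 * (1 + S) / (2 * m)))"
      using S_nonneg finite_V by (intro sum_mono2) auto
    also have "\<dots> = (\<Sum>v\<in>V. d v) * (5 * (1 + S) / (2 * m))"
      by (simp only: sum_distrib_right)
    also have "\<dots> \<le> (4 * real k - 2) * m * (5 * (1 + S) / (2 * m))"
      using sum_degree_le S_nonneg by (intro mult_right_mono) auto
    also have "\<dots> = (5 * real k - 5 / 2) * (2 * (1 + S))"
      using m_ge_k k_real by (simp add: field_simps)
    finally show ?thesis .
  qed
  ultimately have "(m + S - 1) * S \<le> m + 2 * ((m - 1) * T + (5 * real k - 5 / 2) * (2 * (1 + S)))"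
    unfolding sum_identity T_def by (intro add_left_mono mult_left_mono) auto
  then show ?thesis by (simp add: algebra_simps)
qed

section \<open>Determining the size and the weights of \<open>A\<close>\<close>

lemma card_A_le: "real (card A) \<le> real k - 1"
  using card_A_less k_ge by simp

lemma T_le_card: "T \<le> card A"
  using sum_mono[of A x "\<lambda>_. 1"] weight_le_1 A_subset by (auto simp: T_def)

text \<open>As \<open>T \<le> k - 1\<close>, the right side of \<open>S_T_bound\<close> is about
  \<open>(2 * k - 1) * m\<close>, against \<open>2 * k * m\<close> on the left; terms of order
  \<open>k^2\<close> cannot make up the gap \<open>m\<close>.\<close>

lemma S_le: "S \<le> 2 * real k"
proof (rule ccontr)
  assume "\<not> ?thesis"
  then have S: "S \<ge> 2 * real k" by simp
  have "2 * real k * (m - 18 * real k + 9) \<le> S * (S + m - 20 * real k + 9)"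
    using S m_ge_k k_real by (intro mult_mono) auto
  also have "\<dots> \<le> m + 2 * (m - 1) * (real k - 1) + 20 * real k - 10"
    using S_T_bound T_le_card card_A_le m_ge_k k_real
    by (smt (verit) mult_left_mono)
  finally have "m \<le> 36 * (real k)\<^sup>2" using k_real by (simp add: algebra_simps power2_eq_square)
  moreover have "(real k)\<^sup>2 > 0" using k_real by simp
  ultimately show False using m_ge by simp
qed

text \<open>A deficit of 1/10 in \<open>T\<close> costs \<open>m / 5\<close> on the right, the bound
  on \<open>S\<close> gives back at most \<open>m / 200\<close>, and the remaining
  \<open>39 / 200 * m\<close> exceeds \<open>36 * k^2\<close>.\<close>

lemma T_ge: "T \<ge> real k - 1 - 1 / 10"
proof (rule ccontr)
  assume "\<not> ?thesis"
  then have T: "T \<le> real k - 1 - 1 / 10" by simp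
  have "(2 * real k - 1 - 1 / 200) * (m - 18 * real k + 7) \<le> S * (S + m - 20 * real k + 9)"
    using S_ge m_ge_k k_real by (intro mult_mono) auto
  also have "\<dots> \<le> m + 2 * (m - 1) * (real k - 1 - 1 / 10) + 20 * real k - 10"
    using S_T_bound T m_ge_k k_real
    by (smt (verit) mult_left_mono)
  finally have "(2 * real k - 1 - 1 / 200) * (m - 18 * real k + 7) \<le>
      m + 2 * (m - 1) * (real k - 1 - 1 / 10) + 20 * real k - 10" .
  moreover have "(2 * real k - 1 - 1 / 200) * (m - 18 * real k + 7) =
      2 * (real k * m) - 201 / 200 * m - 36 * (real k)\<^sup>2 + 3209 / 100 * real k - 1407 / 200"
    by (simp add: field_simps power2_eq_square)
  moreover have "2 * (m - 1) * (real k - 1 - 1 / 10) = 2 * (real k * m) - 22 / 10 * m - 2 * real k + 22 / 10"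
    by (simp add: field_simps)
  ultimately have "(39 / 200) * m \<le> 36 * (real k)\<^sup>2" using k_real by linarith
  moreover have "(real k)\<^sup>2 > 0" using k_real by simp
  ultimately show False using m_ge by simp
qed

lemma card_A: "card A + 1 = k"
proof -
  have "real (card A) > real k - 2" using T_ge T_le_card by simp
  then have "card A + 2 > k" by linarith
  then show ?thesis using card_A_less k_ge by simp
qed

text \<open>The \<open>k - 1\<close> weights in \<open>A\<close> are at most 1, so none can fall
  short of 1 by more than the total deficit 1/10.\<close>

lemma weight_A:
  assumes "a \<in> A" shows "x a \<ge> 9 / 10"
proof -
  have "(\<Sum>v\<in>A - {a}. x v) \<le> (\<Sum>v\<in>A - {a}. 1)"
    using weight_le_1 A_subset by (intro sum_mono) auto
  moreover have "T = x a + (\<Sum>v\<in>A - {a}. x v)"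
    using assms finite_A by (simp add: T_def sum.remove)
  moreover have "real (card (A - {a})) = real k - 2"
    using card_A k_ge assms finite_A by (simp add: card_Diff_singleton of_nat_diff flip: card_A)
  ultimately show ?thesis using T_ge by simp
qed

text \<open>With \<open>x a \<ge> 9 / 10\<close>, \<open>weight_bound\<close> gives
  \<open>m - d a \<le> (10 + S) / 9\<close>.\<close>

lemma card_nonneighbours:
  assumes "a \<in> A" shows "card (V - A - E `` {a}) \<le> 2 * k"
proof -
  have a: "a \<in> V" using assms A_subset by auto
  have "(m - d a + S) * (9 / 10) \<le> (m - d a + S) * x a"
    using weight_A[OF assms] degree_le[OF a] S_nonneg by (intro mult_left_mono) auto
  also have "\<dots> \<le> 1 + S" by (rule weight_bound[OF a])
  finally have "m - d a \<le> 2 * real k" using S_le k_real by simp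
  moreover have "card (V - A - E `` {a}) \<le> card (V - E `` {a})"
    using finite_V by (intro card_mono) auto
  moreover have "real (card (V - E `` {a})) = m - d a"
    using Image_subset[of "{a}"] finite_V card_mono[OF finite_V Image_subset[of "{a}"]]
    by (simp add: card_Diff_subset of_nat_diff)
  ultimately show ?thesis by linarith
qed

text \<open>There are O(m) arcs, each contributing O(k^2 / m^2), and \<open>m\<close> is at least
  \<open>399 * k^2\<close>.\<close>

lemma qform_rest: "qform (E \<inter> (V - A) \<times> (V - A)) x < 1"
proof -
  let ?F = "E \<inter> (V - A) \<times> (V - A)" and ?K = "(real k)\<^sup>2"
  have "A \<noteq> {}" using card_A k_ge by auto
  then obtain a where a: "a \<in> A" by blast
  have "card ?F \<le> 2 * card V + (2 * k)\<^sup>2"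
    using card_arcs_rest[OF card_A a] power_mono[OF card_nonneighbours[OF a], of 2] by simp
  then have "real (card ?F) \<le> real (2 * card V + (2 * k)\<^sup>2)" by (rule of_nat_mono)
  then have cF: "real (card ?F) \<le> 2 * m + 4 * ?K" by (simp add: power_mult_distrib)
  have m0: "m > 0" using m_ge_k k_real by simp
  have xB: "x v \<le> 25 * real k / (4 * m)" if "v \<in> V - A" for v
  proof -
    have "x v \<le> 5 * (1 + S) / (2 * m)" by (rule weight_rest[OF that])
    \<comment> \<open>\<open>1 + S \<le> 1 + 2 * k \<le> 5 / 2 * k\<close>, the latter by
      \<open>k \<ge> 2\<close>.\<close>
    also have "\<dots> \<le> 5 * (5 / 2 * real k) / (2 * m)"
      using S_le m0 k_real by (intro divide_right_mono) auto
    finally show ?thesis by simp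
  qed
  have "(x u + x v)\<^sup>2 \<le> (25 * real k / (2 * m))\<^sup>2" if "u \<in> V - A" "v \<in> V - A" for u v
  proof (intro power_mono add_nonneg_nonneg x_nonneg)
    have "x u + x v \<le> 25 * real k / (4 * m) + 25 * real k / (4 * m)"
      using xB that by (intro add_mono) auto
    then show "x u + x v \<le> 25 * real k / (2 * m)" by simp
  qed
  then have "qform ?F x \<le> card ?F * (25 * real k / (2 * m))\<^sup>2"
    unfolding qform_def using sum_bounded_above[of ?F "\<lambda>(u, v). (x u + x v)\<^sup>2"] by fastforce
  also have "\<dots> \<le> (2 * m + 4 * ?K) * (25 * real k / (2 * m))\<^sup>2"
    using cF by (intro mult_right_mono) auto
  also have "\<dots> = 625 / 2 * (m + 2 * ?K) * ?K / m\<^sup>2"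
    using m0 by (simp add: field_simps power2_eq_square)
  also have "\<dots> < 1"
  proof -
    have K: "?K \<le> m / 399" "?K \<ge> 0" using m_ge by auto
    have "625 / 2 * (m + 2 * ?K) * ?K \<le> 625 / 2 * (m + 2 * (m / 399)) * (m / 399)"
      using K m0 by (intro mult_mono) auto
    also have "\<dots> = (250625 / 318402) * (m * m)" by (simp add: field_simps)
    also have "\<dots> < m * m" using m0 by simp
    finally show ?thesis using m0 by (simp add: power2_eq_square)
  qed
  finally show ?thesis .
qed

end

section \<open>Comparison with the extremal graph\<close>

text \<open>For \<open>L\<close> of size \<open>k\<close> this is a copy of the extremal graph on an
  arbitrary vertex set, so that it can be placed on the vertices of \<open>G\<close> itself.\<close>

definition S_plus_arcs :: "'a set \<Rightarrow> 'a set \<Rightarrow> 'a \<Rightarrow> 'a \<Rightarrow> 'a rel" where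
  "S_plus_arcs V L b b' =
    {(u, v). u \<in> V \<and> v \<in> V \<and> u \<noteq> v \<and> (u \<in> L \<or> v \<in> L)} \<union> {(b, b'), (b', b)}"

lemma pverts_S_plus_graph: "k \<le> n \<Longrightarrow> pverts (S_plus_graph n k) = {0..<n}"
  by (auto simp: S_plus_graph_def S_graph_def add_edge_def graph_join_def
      complement_def complete_graph_def)

lemma parcs_S_plus_graph:
  "k \<le> n \<Longrightarrow> parcs (S_plus_graph n k) = S_plus_arcs {0..<n} {0..<k} k (k + 1)"
  by (auto simp: S_plus_graph_def S_graph_def add_edge_def graph_join_def
      complement_def complete_graph_def S_plus_arcs_def)

lemma S_plus_arcs_image:
  assumes "bij_betw f V V'" "L \<subseteq> V"
  shows "map_prod f f ` S_plus_arcs V L b b' = S_plus_arcs V' (f ` L) (f b) (f b')"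
proof -
  have f: "f u \<in> V'" "f u \<in> f ` L \<longleftrightarrow> u \<in> L" if "u \<in> V" for u
    using that assms by (auto simp: bij_betw_def inj_on_def)
  have g: "\<exists>u\<in>V. f u = v" if "v \<in> V'" for v
    using that assms by (auto simp: bij_betw_def)
  have i: "f u = f v \<longleftrightarrow> u = v" if "u \<in> V" "v \<in> V" for u v
    using that assms by (auto simp: bij_betw_def inj_on_def)
  have "map_prod f f ` {(u, v). u \<in> V \<and> v \<in> V \<and> u \<noteq> v \<and> (u \<in> L \<or> v \<in> L)} =
      {(u, v). u \<in> V' \<and> v \<in> V' \<and> u \<noteq> v \<and> (u \<in> f ` L \<or> v \<in> f ` L)}" (is "?l = ?r")
  proof
    show "?l \<subseteq> ?r" using f i by auto
    show "?r \<subseteq> ?l"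
    proof
      fix e assume e: "e \<in> ?r"
      then have "fst e \<in> V'" "snd e \<in> V'" by auto
      with g obtain u v where uv: "u \<in> V" "v \<in> V" "f u = fst e" "f v = snd e" by metis
      then have uv: "u \<in> V" "v \<in> V" "e = (f u, f v)" by auto
      then have "(u, v) \<in> {(u, v). u \<in> V \<and> v \<in> V \<and> u \<noteq> v \<and> (u \<in> L \<or> v \<in> L)}"
        using e f(2) by auto
      then show "e \<in> ?l" using uv(3) by force
    qed
  qed
  then show ?thesis by (simp add: S_plus_arcs_def image_Un)
qed

lemma S_plus_labelling:
  assumes "finite V" "card V = n" "L \<subseteq> V" "card L = k" "b \<in> V - L" "b' \<in> V - L" "b \<noteq> b'"
  obtains f where "bij_betw f {0..<n} V"
    "map_prod f f ` parcs (S_plus_graph n k) = S_plus_arcs V L b b'"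
proof -
  obtain ls rs where ls: "set ls = L" "distinct ls" and rs: "set rs = V - L - {b, b'}" "distinct rs"
    using assms by (meson finite_distinct_list finite_Diff finite_subset)
  \<comment> \<open>This order puts \<open>L\<close> at the indices below \<open>k\<close>, and
    \<open>b\<close>, \<open>b'\<close> at \<open>k\<close> and \<open>k + 1\<close>.\<close>
  define vs where "vs = ls @ [b, b'] @ rs"
  have vs: "distinct vs" "set vs = V" using ls rs assms by (auto simp: vs_def)
  have len: "length vs = n" "length ls = k" using vs ls assms distinct_card by metis+
  have bij: "bij_betw ((!) vs) {0..<n} V"
    using vs len by (intro bij_betw_nth) auto
  have kn: "k + 2 \<le> n" using len by (simp add: vs_def)
  have "(!) vs ` {0..<k} = (!) ls ` {0..<k}"
    using len by (intro image_cong) (auto simp: vs_def nth_append)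
  also have "\<dots> = L" using len ls by (auto simp: set_conv_nth)
  finally have im: "(!) vs ` {0..<k} = L" .
  have "vs ! k = b" "vs ! (k + 1) = b'"
    using len by (auto simp: vs_def nth_append)
  then have "map_prod ((!) vs) ((!) vs) ` parcs (S_plus_graph n k) = S_plus_arcs V L b b'"
    using S_plus_arcs_image[OF bij, of "{0..<k}" k "k + 1"] kn im by (simp add: parcs_S_plus_graph)
  with that bij show ?thesis by blast
qed

lemma qform_image:
  assumes "inj_on f V" "E \<subseteq> V \<times> V"
  shows "qform (map_prod f f ` E) x = qform E (x \<circ> f)"
proof -
  have "inj_on (map_prod f f) E"
    using map_prod_inj_on[OF assms(1) assms(1)] assms(2) inj_on_subset by blast
  then show ?thesis
    unfolding qform_def by (subst sum.reindex) (auto intro!: sum.cong)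
qed

lemma qform_S_plus_arcs_le:
  assumes "finite V" "card V = n" "L \<subseteq> V" "card L = k" "b \<in> V - L" "b' \<in> V - L" "b \<noteq> b'"
  shows "qform (S_plus_arcs V L b b') x \<le> 2 * q_index (S_plus_graph n k) * (\<Sum>v\<in>V. (x v)\<^sup>2)"
proof -
  let ?S = "S_plus_graph n k"
  obtain f where f: "bij_betw f {0..<n} V" "map_prod f f ` parcs ?S = S_plus_arcs V L b b'"
    using S_plus_labelling[OF assms] .
  have "card (insert b (insert b' L)) \<le> card V" using assms by (intro card_mono) auto
  moreover have "finite L" using assms finite_subset by blast
  ultimately have kn: "k + 2 \<le> n" using assms by simp
  interpret S: finite_graph "pverts ?S" "parcs ?S"
    using pair_graph_S_plus_graph[OF kn] by (rule finite_graph_pair_graph)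
  have V: "pverts ?S = {0..<n}" using kn by (simp add: pverts_S_plus_graph)
  have "qform (S_plus_arcs V L b b') x = qform (parcs ?S) (x \<circ> f)"
    using f qform_image[of f "{0..<n}" "parcs ?S" x] S.E_subset V by (auto simp: bij_betw_def)
  also have "\<dots> \<le> 2 * q_index ?S * (\<Sum>v\<in>pverts ?S. ((x \<circ> f) v)\<^sup>2)"
  proof (rule q_index_perron[OF pair_graph_S_plus_graph[OF kn]])
    show "pverts ?S \<noteq> {}" using kn V by auto
  qed blast
  also have "(\<Sum>v\<in>pverts ?S. ((x \<circ> f) v)\<^sup>2) = (\<Sum>v\<in>V. (x v)\<^sup>2)"
    using sum.reindex_bij_betw[OF f(1), of "\<lambda>v. (x v)\<^sup>2"] V by simp
  finally show ?thesis .
qed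

lemma digraph_iso_S_plus_graph:
  assumes G: "pair_graph G" and "card (pverts G) = n" "L \<subseteq> pverts G" "card L = k"
    and "b \<in> pverts G - L" "b' \<in> pverts G - L" "b \<noteq> b'"
    and E: "parcs G = S_plus_arcs (pverts G) L b b'"
  shows "digraph_iso (with_proj G) (with_proj (S_plus_graph n k))"
proof -
  let ?S = "S_plus_graph n k"
  interpret G: pair_graph G by fact
  have fin: "finite (pverts G)" by (rule G.pair_finite_verts)
  obtain f where f: "bij_betw f {0..<n} (pverts G)" "map_prod f f ` parcs ?S = parcs G"
    using S_plus_labelling[OF fin assms(2-7)] E by metis
  have "card (insert b (insert b' L)) \<le> card (pverts G)" using assms fin by (intro card_mono) auto
  moreover have "finite L" using assms fin finite_subset by blast
  ultimately have kn: "k + 2 \<le> n" using assms by simp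
  interpret S: finite_graph "pverts ?S" "parcs ?S"
    using pair_graph_S_plus_graph[OF kn] by (rule finite_graph_pair_graph)
  have V: "pverts ?S = {0..<n}" using kn by (simp add: pverts_S_plus_graph)
  define g where "g = the_inv_into {0..<n} f"
  have g: "bij_betw g (pverts G) {0..<n}"
    unfolding g_def by (rule bij_betw_the_inv_into[OF f(1)])
  have gf: "g (f u) = u" if "u \<in> {0..<n}" for u
    using that f(1) by (simp add: g_def bij_betw_def the_inv_into_f_f)
  have "map_prod g g ` parcs G = (map_prod g g \<circ> map_prod f f) ` parcs ?S"
    by (simp add: f(2)[symmetric] image_comp)
  also have "\<dots> = id ` parcs ?S"
    using S.E_subset V gf by (intro image_cong) auto
  finally have arcs: "map_prod g g ` parcs G = parcs ?S" by simp
  define h where "h = \<lparr>iso_verts = g, iso_arcs = map_prod g g, iso_head = snd, iso_tail = fst\<rparr>"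
  have inj: "inj_on g (pverts G)" using g by (simp add: bij_betw_def)
  then have "inj_on (map_prod g g) (parcs G)"
    using map_prod_inj_on[OF inj inj] inj_on_subset finite_graph.E_subset[OF finite_graph_pair_graph[OF G]]
    by blast
  then have "pre_digraph.digraph_isomorphism (with_proj G) h"
    using inj G.wf_digraph_axioms by (auto simp: pre_digraph.digraph_isomorphism_def h_def)
  moreover have "with_proj ?S = app_iso h (with_proj G)"
    using arcs g V by (simp add: app_iso_def with_proj_def h_def bij_betw_def)
  ultimately show ?thesis unfolding digraph_iso_def by blast
qed

text \<open>The test vector is 1 on the clique and \<open>k / n\<close> on the other vertices; its Rayleigh quotient
  already on \<open>S_graph n k\<close> is \<open>n + 2k - 2\<close> up to an error of \<open>2k\<^sup>2 / n \<le> 1 / 200\<close>.\<close>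

lemma q_index_S_plus_graph_ge:
  assumes k: "k \<ge> 1" and n: "n \<ge> 400 * k\<^sup>2"
  shows "q_index (S_plus_graph n k) \<ge> real n + 2 * real k - 2 - 1 / 200"
proof -
  let ?S = "S_plus_graph n k"
  have "k \<le> k * k" by (rule le_square)
  then have kn: "k + 2 \<le> n" "k \<le> n" using n k unfolding power2_eq_square by linarith+
  define t where "t = real k / real n"
  define y where "y = (\<lambda>v. if v < k then 1 else t)"
  define q0 where "q0 = real n + 2 * real k - 2 - 1 / 200"
  define r where "r = real n - real k"
  have n0: "real n > 0" using kn by simp
  have V: "pverts ?S = {0..<n}" using kn by (simp add: pverts_S_plus_graph)
  interpret S: finite_graph "pverts ?S" "parcs ?S"
    using pair_graph_S_plus_graph[OF kn(1)] by (rule finite_graph_pair_graph)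
  have norm: "(\<Sum>v\<in>{0..<n}. (y v)\<^sup>2) = real k + r * t\<^sup>2"
  proof -
    have "(\<Sum>v\<in>{0..<n}. (y v)\<^sup>2) = (\<Sum>v\<in>{0..<k}. (y v)\<^sup>2) + (\<Sum>v\<in>{k..<n}. (y v)\<^sup>2)"
      using kn by (simp add: sum.atLeastLessThan_concat)
    then show ?thesis using kn by (simp add: y_def r_def of_nat_diff)
  qed
  \<comment> \<open>Arcs inside the clique and, in both directions, between clique and rest. The
    added edge is dropped, which only lowers the sum.\<close>
  define K1 where "K1 = (SIGMA u:{0..<k}. {0..<k} - {u})"
  define K2 where "K2 = {0..<k} \<times> {k..<n}"
  define K3 where "K3 = {k..<n} \<times> {0..<k}"
  have fin: "finite K1" "finite K2" "finite K3" by (auto simp: K1_def K2_def K3_def)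
  have "card K1 = k * (k - 1)" by (simp add: K1_def)
  then have c1: "real (card K1) = real k * (real k - 1)" using k by (simp add: of_nat_diff)
  have c23: "real (card K2) = real k * r" "real (card K3) = real k * r"
    using kn by (simp_all add: K2_def K3_def card_cartesian_product r_def of_nat_diff)
  let ?g = "\<lambda>(u, v). (y u + y v)\<^sup>2"
  have "K1 \<inter> K2 = {}" "(K1 \<union> K2) \<inter> K3 = {}" by (auto simp: K1_def K2_def K3_def)
  then have "sum ?g K1 + sum ?g K2 + sum ?g K3 = sum ?g (K1 \<union> K2 \<union> K3)"
    using fin by (simp only: sum.union_disjoint finite_Un)
  also have "\<dots> \<le> qform (parcs ?S) y"
    unfolding qform_def using S.finite_E kn
    by (intro sum_mono2) (auto simp: K1_def K2_def K3_def parcs_S_plus_graph S_plus_arcs_def)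
  also have "\<dots> \<le> 2 * q_index ?S * (\<Sum>v\<in>pverts ?S. (y v)\<^sup>2)"
  proof (rule q_index_perron[OF pair_graph_S_plus_graph[OF kn(1)]])
    show "pverts ?S \<noteq> {}" using kn V by auto
  qed blast
  also have "\<dots> = 2 * q_index ?S * (real k + r * t\<^sup>2)" using norm V by simp
  finally have "sum ?g K1 + sum ?g K2 + sum ?g K3 \<le> 2 * q_index ?S * (real k + r * t\<^sup>2)" .
  moreover have "sum ?g K1 = (\<Sum>e\<in>K1. 4)"
    by (intro sum.cong) (auto simp: K1_def y_def)
  moreover have "sum ?g K2 = (\<Sum>e\<in>K2. (1 + t)\<^sup>2)"
    by (intro sum.cong) (auto simp: K2_def y_def)
  moreover have "sum ?g K3 = (\<Sum>e\<in>K3. (1 + t)\<^sup>2)"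
    by (intro sum.cong) (auto simp: K3_def y_def add.commute)
  ultimately have *: "4 * (real k * (real k - 1)) + 2 * (real k * r * (1 + t)\<^sup>2) \<le> 2 * q_index ?S * (real k + r * t\<^sup>2)"
    by (simp add: c1 c23 mult_ac)
  have **: "q0 * (real k + r * t\<^sup>2) \<le> 2 * (real k * (real k - 1)) + real k * r * (1 + t)\<^sup>2"
  proof -
    let ?n = "real n" and ?k = "real k"
    have "real n \<ge> real (400 * k\<^sup>2)" using n by (rule of_nat_mono)
    then have n4: "?n \<ge> 400 * ?k\<^sup>2" by simp
    have tn: "t * ?n = ?k" using n0 by (simp add: t_def)
    \<comment> \<open>Writing \<open>k\<close> as \<open>t * n\<close> makes this a polynomial
      identity. The first two terms on the right are \<open>k / 200 - 2 * k^3 / n\<close>,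
      nonnegative by \<open>n \<ge> 400 * k^2\<close>; the others are nonnegative anyway.\<close>
    have "2 * (?k * (?k - 1)) + ?k * r * (1 + t)\<^sup>2 - q0 * (?k + r * t\<^sup>2) =
       ?k / 200 - 2 * ?k * ?k * t + ?k * ?k * t * t + (2 + 1 / 200) * r * t\<^sup>2"
      unfolding q0_def r_def tn[symmetric] by (simp add: field_simps power2_eq_square)
    moreover have "?k / 200 - 2 * ?k * ?k * t \<ge> 0"
    proof -
      have "2 * ?k * ?k * t = ?k * (2 * ?k\<^sup>2 / ?n)" by (simp add: t_def power2_eq_square)
      also have "\<dots> \<le> ?k * (1 / 200)"
        using n4 n0 by (intro mult_left_mono) (auto simp: field_simps)
      finally show ?thesis by simp
    qed
    moreover have "?k * ?k * t * t \<ge> 0" "(2 + 1 / 200) * r * t\<^sup>2 \<ge> 0"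
      using kn by (auto simp: r_def t_def)
    ultimately show ?thesis by linarith
  qed
  have "q0 * (real k + r * t\<^sup>2) \<le> q_index ?S * (real k + r * t\<^sup>2)" using * ** by linarith
  moreover have "real k + r * t\<^sup>2 > 0" using k kn by (auto simp: r_def intro!: add_pos_nonneg)
  ultimately show ?thesis unfolding q0_def by (metis mult_le_cancel_right_pos)
qed

section \<open>Deleting a dominating vertex and identifying the graph\<close>

lemma hub_of_max_degree:
  assumes G: "pair_graph G" and "card (pverts G) = n" "n > 0" "max_degree G = n - 1"
  obtains w where "w \<in> pverts G" "parcs G `` {w} = pverts G - {w}"
proof -
  interpret G: pair_graph G by fact
  interpret finite_graph "pverts G" "parcs G" using G by (rule finite_graph_pair_graph)
  have "out_degree G ` pverts G \<noteq> {}" using assms by auto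
  then have "max_degree G \<in> out_degree G ` pverts G"
    unfolding max_degree_def using finite_V by (intro Max_in) auto
  then obtain w where w: "w \<in> pverts G" "card (parcs G `` {w}) = n - 1"
    using assms(4) by (auto simp: out_degree_with_proj)
  have "parcs G `` {w} \<subseteq> pverts G - {w}" using Image_subset G.no_loops' by blast
  moreover have "card (pverts G - {w}) = n - 1" using w assms(2) by simp
  ultimately have "parcs G `` {w} = pverts G - {w}"
    using w(2) finite_V by (intro card_subset_eq) auto
  with that w(1) show ?thesis by blast
qed

theorem theorem13:
  fixes G :: "'a pair_pre_digraph" and n k :: nat
  assumes "k \<ge> 2" and "n \<ge> 400 * k ^ 2"
    and "pair_graph G" and "card (pverts G) = n"
    and "max_degree G = n - 1"
    and "q_index G \<ge> q_index (S_plus_graph n k)"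
    and "\<not> digraph_iso (with_proj G) (with_proj (S_plus_graph n k))"
  shows "\<exists>p. pre_digraph.cycle (with_proj G) p \<and> length p = 2 * k + 2"
proof (rule ccontr)
  assume no_cycle: "\<nexists>p. pre_digraph.cycle (with_proj G) p \<and> length p = 2 * k + 2"
  interpret G: pair_graph G by fact
  interpret FG: finite_graph "pverts G" "parcs G" using assms(3) by (rule finite_graph_pair_graph)
  let ?E = "parcs G" and ?q = "q_index G"
  have "2 * 2 \<le> k * k" using assms(1) by (intro mult_mono) auto
  then have n_pos: "n > 0" using assms(2) by (simp add: power2_eq_square)
  obtain w where w: "w \<in> pverts G" "?E `` {w} = pverts G - {w}"
    using hub_of_max_degree[OF assms(3,4) n_pos assms(5)] .
  define U where "U = pverts G - {w}"
  define H where "H = ?E \<inter> U \<times> U"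
  have U: "w \<notin> U" "pverts G = insert w U" "finite U"
    using w(1) FG.finite_V by (auto simp: U_def)
  then have card_U: "card U + 1 = n" using assms(4) by simp
  have w_adj: "(w, v) \<in> ?E" "(v, w) \<in> ?E" if "v \<in> U" for v
    using w that FG.E_iff[of v w] by (auto simp: U_def)
  have H_Image: "?E `` {v} = insert w (H `` {v})" if "v \<in> U" for v
    using that w_adj FG.E_subset U by (auto simp: H_def)
  have w_H: "w \<notin> H `` {v}" for v using U by (auto simp: H_def)
  interpret H: finite_graph U H
    using U(3) FG.E_iff by unfold_locales (auto simp: H_def intro!: symI)

  have ne: "pverts G \<noteq> {}" using w(1) by auto
  obtain x0 where x0: "\<And>v. 0 \<le> x0 v" "(\<Sum>v\<in>pverts G. (x0 v)\<^sup>2) = 1"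
    "\<And>v. v \<in> pverts G \<Longrightarrow> qop ?E x0 v = ?q * x0 v"
    "\<And>y. qform ?E y \<le> 2 * ?q * (\<Sum>v\<in>pverts G. (y v)\<^sup>2)"
    using q_index_perron[OF assms(3) ne] by blast
  have "x0 w \<noteq> 0"
  proof
    assume w0: "x0 w = 0"
    have "(\<Sum>u\<in>U. x0 u) = 0" using x0(3)[OF w(1)] w0 by (simp add: qop_def w U_def)
    then have "\<forall>u\<in>U. x0 u = 0" using x0(1) U(3) by (simp add: sum_nonneg_eq_0_iff)
    then have "(\<Sum>v\<in>pverts G. (x0 v)\<^sup>2) = 0" using U w0 by (intro sum.neutral) auto
    then show False using x0(2) by simp
  qed
  then have w_pos: "x0 w > 0" using x0(1)[of w] by linarith
  define x where "x = (\<lambda>v. x0 v / x0 w)"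
  have x: "0 \<le> x v" "x w = 1" for v using x0(1) w_pos by (auto simp: x_def)
  have qop_x: "qop ?E x v = ?q * x v" if "v \<in> pverts G" for v
    using x0(3)[OF that] by (simp add: x_def qop_def add_divide_distrib[symmetric]
        sum_divide_distrib[symmetric])
  define S where "S = (\<Sum>v\<in>U. x v)"
  have q_S: "?q = card U + S"
    using qop_x[OF w(1)] x(2) by (simp add: qop_def w sum.distrib S_def U_def)
  have "irrefl H" using G.no_loops' by (auto simp: irrefl_def H_def)
  moreover have "\<nexists>p. is_path H p \<and> length p = 2 * k + 1"
  proof
    assume "\<exists>p. is_path H p \<and> length p = 2 * k + 1"
    then obtain p where p: "is_path H p" "length p = 2 * k + 1" by blast
    \<comment> \<open>\<open>is_path\<close> does not mention \<open>U\<close>, but every vertex of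
      \<open>p\<close> lies on an arc of \<open>H\<close>, as there are at least two.\<close>
    have "set p \<subseteq> U"
    proof
      fix v assume "v \<in> set p"
      then obtain i where i: "i < length p" "p ! i = v" by (auto simp: in_set_conv_nth)
      have suc: "(p ! j, p ! Suc j) \<in> H" if "Suc j < length p" for j
        using p(1) that by (auto simp: is_path_def successively_conv_nth)
      show "v \<in> U"
      proof (cases i)
        case 0
        then show ?thesis using suc[of 0] p(2) assms(1) i by (auto simp: H_def)
      next
        case (Suc j)
        then show ?thesis using suc[of j] i by (auto simp: H_def)
      qed
    qed
    moreover have p_ne: "p \<noteq> []" using p(2) by auto
    ultimately have ends: "w \<notin> set p" "hd p \<in> U" "last p \<in> U"
      using U(1) hd_in_set[OF p_ne] last_in_set[OF p_ne] by blast+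
    have "is_path ?E p"
      using p(1) by (auto simp: is_path_def H_def elim!: successively_mono)
    from cycle_through_hub[OF this p_ne w(1) ends(1) w_adj(1)[OF ends(2)] w_adj(2)[OF ends(3)]]
    show False using p(2) no_cycle by simp
  qed
  moreover have "card U + 1 \<ge> 400 * k\<^sup>2" using assms(2) card_U by simp
  \<comment> \<open>In \<open>G\<close> the vertex has one more neighbour, the hub, which adds
    \<open>x v + 1\<close> to \<open>qop\<close>.\<close>
  moreover have "(card U + S - 1 - card (H `` {v})) * x v = 1 + (\<Sum>u\<in>H `` {v}. x u)"
    if v: "v \<in> U" for v
  proof -
    have "v \<in> pverts G" using v U by auto
    from qop_x[OF this] show ?thesis
      using w_H[of v] x(2) by (simp add: qop_def H_Image[OF v] sum.distrib q_S algebra_simps)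
  qed
  moreover have "S \<ge> 2 * real k - 1 - 1 / 200"
  proof -
    have "real n = real (card U) + 1" using card_U by (metis of_nat_1 of_nat_add)
    then show ?thesis
      using q_index_S_plus_graph_ge[of k n] assms(1,2,6) q_S by simp
  qed
  ultimately interpret perron_hub U H x S k
    using assms(1) x(1) by unfold_locales (auto simp: S_def)

  \<comment> \<open>\<open>K\<close> holds the arcs of a copy of \<open>S_graph\<close> with clique
    \<open>L\<close>; \<open>F\<close> holds the arcs of \<open>G\<close> that avoid
    \<open>L\<close>.\<close>
  define L where "L = insert w A"
  define F where "F = H \<inter> (U - A) \<times> (U - A)"
  define K where "K = {(u, v). u \<in> pverts G \<and> v \<in> pverts G \<and> u \<noteq> v \<and> (u \<in> L \<or> v \<in> L)}"
  have "w \<notin> A" using A_subset U(1) by blast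
  then have L: "L \<subseteq> pverts G" "card L = k" "pverts G - L = U - A"
    using A_subset U card_A finite_A by (auto simp: L_def)
  have E_split: "?E = (?E \<inter> K) \<union> F" "?E \<inter> K \<inter> F = {}"
    using FG.E_subset G.no_loops' U L by (auto simp: K_def F_def H_def L_def)
  have finK: "finite K"
    by (rule finite_subset[of _ "pverts G \<times> pverts G"]) (auto simp: K_def FG.finite_V)
  have finF: "finite F" using H.finite_E by (simp add: F_def)
  have qE: "qform ?E x = qform (?E \<inter> K) x + qform F x"
    unfolding qform_def using finK finF E_split by (metis finite_Int sum.union_disjoint)
  have qK: "qform K x = qform (?E \<inter> K) x + qform (K - ?E) x"
    unfolding qform_def using sum.Int_Diff[OF finK, of _ ?E] by (simp only: Int_commute)

  \<comment> \<open>Compare \<open>q(G)\<close> with the Rayleigh quotient of the Perron vector of \<open>G\<close> on a copy of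
    \<open>S_plus_graph n k\<close> with clique \<open>L\<close> and extra edge \<open>bb'\<close>.\<close>
  have key: "qform (K - ?E) x + 2 * (x b + x b')\<^sup>2 \<le> qform F x"
    if b: "b \<in> U - A" "b' \<in> U - A" "b \<noteq> b'" for b b'
  proof -
    have "K \<inter> {(b, b'), (b', b)} = {}" using b L by (auto simp: K_def)
    then have "qform (S_plus_arcs (pverts G) L b b') x = qform K x + 2 * (x b + x b')\<^sup>2"
      unfolding S_plus_arcs_def K_def[symmetric] qform_def
      using finK b(3) by (subst sum.union_disjoint) (auto simp: add.commute)
    moreover have "qform (S_plus_arcs (pverts G) L b b') x \<le>
        2 * q_index (S_plus_graph n k) * (\<Sum>v\<in>pverts G. (x v)\<^sup>2)"
      using b L by (intro qform_S_plus_arcs_le FG.finite_V assms(4)) auto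
    moreover have "\<dots> \<le> 2 * ?q * (\<Sum>v\<in>pverts G. (x v)\<^sup>2)"
      using assms(6) by (intro mult_right_mono sum_nonneg) auto
    moreover have "\<dots> = qform ?E x" using FG.qform_eigen[OF qop_x] by simp
    ultimately show ?thesis using qE qK by linarith
  qed

  have "finite (U - A)" using U by simp
  have "card (U - A) \<ge> 2"
  proof -
    have "real (k + 1) \<le> real (card U)" using m_ge_k k_real by simp
    then have "card U \<ge> k + 1" by (simp only: of_nat_le_iff)
    then show ?thesis using card_A by (simp add: card_Diff_subset A_subset finite_A)
  qed
  \<comment> \<open>\<open>key\<close> needs some pair for the extra edge, even if \<open>F\<close>
    offers none.\<close>
  then obtain b0 b0' where b0: "b0 \<in> U - A" "b0' \<in> U - A" "b0 \<noteq> b0'"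
    by (metis card_2_iff' card_le_Suc0_iff_eq not_less_eq_eq numeral_2_eq_2 \<open>finite (U - A)\<close>)

  have complete: "K \<subseteq> ?E"
  proof (rule ccontr)
    assume "\<not> K \<subseteq> ?E"
    then obtain u v where uv: "(u, v) \<in> K - ?E" by auto
    then have vu: "(v, u) \<in> K - ?E" "u \<noteq> v" using FG.E_iff by (auto simp: K_def)
    \<comment> \<open>All arcs at the hub are present, so a missing one meets \<open>A\<close>.
      Counted in both directions it weighs at least \<open>2 * (9 / 10)^2 > 1\<close>, more than all
      of \<open>F\<close>.\<close>
    have "u \<noteq> w" "v \<noteq> w" using uv w_adj U by (auto simp: K_def)
    then have "u \<in> A \<or> v \<in> A" using uv by (auto simp: K_def L_def)
    then have "x u + x v \<ge> 9 / 10" using weight_A x(1)[of u] x(1)[of v]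
      by (metis add_increasing add_increasing2)
    then have "(x u + x v)\<^sup>2 \<ge> (9 / 10)\<^sup>2" by (intro power_mono) auto
    then have "2 * (9 / 10)\<^sup>2 \<le> (\<Sum>(a, b)\<in>{(u, v), (v, u)}. (x a + x b)\<^sup>2)"
      using vu(2) by (simp add: add.commute)
    also have "\<dots> \<le> qform (K - ?E) x"
      unfolding qform_def using uv vu finK by (intro sum_mono2) auto
    also have "\<dots> \<le> qform F x" using key[OF b0] by (smt (verit) zero_le_power2)
    also have "\<dots> < 1" unfolding F_def by (rule qform_rest)
    finally show False by (simp add: power2_eq_square)
  qed

  show False
  proof (cases "F = {}")
    case True
    \<comment> \<open>Here \<open>G\<close> is a copy of \<open>S_graph\<close>; as the weights are
      positive, the extra edge raises the Rayleigh quotient strictly.\<close>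
    have "K - ?E = {}" using complete by auto
    then have "qform (K - ?E) x = 0" by (simp only: qform_def sum.empty)
    moreover have "qform F x = 0" using True by (simp add: qform_def)
    ultimately have "2 * (x b0 + x b0')\<^sup>2 \<le> 0" using key[OF b0] by linarith
    moreover have "x b0 + x b0' > 0" using weight_pos b0 by (simp add: add_pos_pos)
    ultimately show False by simp
  next
    case False
    then obtain b b' where F: "(b, b') \<in> F" by auto
    then have b: "b \<in> U - A" "b' \<in> U - A" "b \<noteq> b'" "(b, b') \<in> H" "(b', b) \<in> H"
      using G.no_loops' H.E_iff by (auto simp: F_def H_def)
    have A_ne: "A \<noteq> {}" using card_A assms(1) by auto
    have A_adj: "(a, v) \<in> H" if "a \<in> A" "v \<in> U - A" for a v
    proof -
      have "(a, v) \<in> K" using that A_subset U by (auto simp: K_def L_def)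
      then show ?thesis using complete that A_subset by (auto simp: H_def)
    qed
    obtain a where a: "a \<in> A" using A_ne by blast
    have P3: "c = b" if "(c, b') \<in> F" "b' \<in> U - A" "b \<in> U - A" "(b, b') \<in> H" for b b' c
      using no_P3[OF card_A, of b b' c a] that a A_adj H.E_iff[of c b'] unfolding F_def by blast
    \<comment> \<open>A second edge in \<open>F\<close> would be disjoint from the first, against
      \<open>no_2P2\<close>, or share one vertex with it, against \<open>no_P3\<close>.\<close>
    have "F \<subseteq> {(b, b'), (b', b)}"
    proof
      fix e assume e: "e \<in> F"
      obtain c c' where cc: "e = (c, c')" by (cases e)
      have c: "c \<in> U - A" "c' \<in> U - A" "(c, c') \<in> F" "(c', c) \<in> F" "c \<noteq> c'" "(c, c') \<in> H"
        using e cc G.no_loops' H.E_iff[of c c'] by (auto simp: F_def H_def)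
      have "\<not> distinct [b, b', c, c']"
      proof
        assume "distinct [b, b', c, c']"
        then show False
          using no_2P2[OF card_A b(4) c(6) _ A_ne] b c A_adj by auto
      qed
      then have "c = b \<or> c = b' \<or> c' = b \<or> c' = b'" using b(3) c(5) by auto
      moreover have "c' = b'" if "c = b"
        using c(4) b(1,2,5) unfolding that by (intro P3)
      moreover have "c' = b" if "c = b'"
        using c(4) b(1,2,4) unfolding that by (intro P3)
      moreover have "c = b'" if "c' = b"
        using c(3) b(1,2,5) unfolding that by (intro P3)
      moreover have "c = b" if "c' = b'"
        using c(3) b(1,2,4) unfolding that by (intro P3)
      ultimately show "e \<in> {(b, b'), (b', b)}" unfolding cc by blast
    qed
    then have "F = {(b, b'), (b', b)}" using F b by (auto simp: F_def)
    then have "?E = S_plus_arcs (pverts G) L b b'"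
      using E_split complete unfolding S_plus_arcs_def K_def[symmetric] by auto
    then have "digraph_iso (with_proj G) (with_proj (S_plus_graph n k))"
      using b L by (intro digraph_iso_S_plus_graph assms(3,4)) auto
    then show False using assms(7) by blast
  qed
qed

end
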